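(* Let $t>0$, let $P_t(x,y):=xy(x-ty)(x-y/t)$, and let $\beta=\beta(t)\in(0,1)$ be defined by $\frac{t+i}{t-i}=e^{2\pi i\beta}$. Suppose there is a constant $C>0$ such that $$\left|\beta-\frac{n}{m}\right|\geq\frac{C}{m^2}\quad\text{for all } n,m\in\mathbb Z,\ m\ne0.$$ Let $0<R\le\infty$ and $c\in A(B_R)$. Then there exists $0<r\le R$ such that for every $f,g\in A(B_R)$ the Goursat problem $$\Delta^2u+cu=f,\qquad P_t\mid(u-g)$$ has a unique solution $u\in A(B_r)$.
   Context: $\Delta$ is the Laplace operator on $\mathbb R^2$. $B_R=\{(x,y): x^2+y^2<R^2\}$ and $A(B_R)$ denotes the algebra of all $C^\infty$ functions $f:B_R\to\mathbb C$ such that for every compact $K\subset B_R$ the homogeneous Taylor series $\sum_m f_m$ of $f$ at $0$ converges absolutely and uniformly to $f$ on $K$. $P_t\mid(u-g)$ means $u-g=P_tq$ with $q$ real-analytic near $0$ (here $q\in A(B_r)$). *)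

theory Defs
  imports "HOL-Analysis.Analysis" "HOL-Library.Extended_Real"
begin

definition pdx :: "(real \<times> real \<Rightarrow> complex) \<Rightarrow> real \<times> real \<Rightarrow> complex" where
  "pdx f = (\<lambda>(x, y). vector_derivative (\<lambda>s. f (s, y)) (at x))"

definition pdy :: "(real \<times> real \<Rightarrow> complex) \<Rightarrow> real \<times> real \<Rightarrow> complex" where
  "pdy f = (\<lambda>(x, y). vector_derivative (\<lambda>s. f (x, s)) (at y))"

fun pdw :: "bool list \<Rightarrow> (real \<times> real \<Rightarrow> complex) \<Rightarrow> real \<times> real \<Rightarrow> complex" where
  "pdw [] f = f"
| "pdw (b # ws) f = (if b then pdx else pdy) (pdw ws f)"

definition smooth_on :: "(real \<times> real) set \<Rightarrow> (real \<times> real \<Rightarrow> complex) \<Rightarrow> bool" where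
  "smooth_on S f \<longleftrightarrow> (\<forall>ws. pdw ws f differentiable_on S)"

definition disc :: "ereal \<Rightarrow> (real \<times> real) set" where
  "disc R = {(x, y). ereal (sqrt (x\<^sup>2 + y\<^sup>2)) < R}"

definition taylor_hom :: "(real \<times> real \<Rightarrow> complex) \<Rightarrow> nat \<Rightarrow> real \<times> real \<Rightarrow> complex" where
  "taylor_hom f m = (\<lambda>(x, y). \<Sum>j\<le>m.
      ((pdx ^^ j) ((pdy ^^ (m - j)) f) (0, 0) / of_nat (fact j * fact (m - j)))
        * of_real (x ^ j) * of_real (y ^ (m - j)))"

definition A_alg :: "ereal \<Rightarrow> (real \<times> real \<Rightarrow> complex) set" where
  "A_alg R = {f. smooth_on (disc R) f \<and>
     (\<forall>K. compact K \<and> K \<subseteq> disc R \<longrightarrow>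
        uniform_limit K (\<lambda>n p. \<Sum>m<n. taylor_hom f m p) f sequentially \<and>
        uniformly_convergent_on K (\<lambda>n p. \<Sum>m<n. norm (taylor_hom f m p)))}"

definition laplacian :: "(real \<times> real \<Rightarrow> complex) \<Rightarrow> real \<times> real \<Rightarrow> complex" where
  "laplacian u = (\<lambda>p. pdx (pdx u) p + pdy (pdy u) p)"

definition Pt :: "real \<Rightarrow> real \<times> real \<Rightarrow> complex" where
  "Pt t = (\<lambda>(x, y). of_real (x * y * (x - t * y) * (x - y / t)))"

definition goursat_sol :: "real \<Rightarrow> ereal \<Rightarrow> (real \<times> real \<Rightarrow> complex) \<Rightarrow> (real \<times> real \<Rightarrow> complex)
      \<Rightarrow> (real \<times> real \<Rightarrow> complex) \<Rightarrow> (real \<times> real \<Rightarrow> complex) \<Rightarrow> bool" where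
  "goursat_sol t r c f g u \<longleftrightarrow> u \<in> A_alg r \<and>
     (\<forall>p\<in>disc r. laplacian (laplacian u) p + c p * u p = f p) \<and>
     (\<exists>q\<in>A_alg r. \<forall>p\<in>disc r. u p - g p = Pt t p * q p)"

end

theory Submission
  imports Defs "HOL-Complex_Analysis.Complex_Analysis"
begin

text \<open>
  In the coordinates \<open>z\<close> and \<open>cnj z\<close> with \<open>z = x + \<i> y\<close>, a homogeneous polynomial of degree \<open>m\<close>
  is \<open>cnj z ^ m * p (z / cnj z)\<close> for a one-variable polynomial \<open>p\<close> of degree at most \<open>m\<close>, and \<open>A(B\<^sub>R)\<close>
  consists of the sums of such terms whose coefficient norms are summable at every radius below
  \<open>R\<close>. The bilaplacian becomes diagonal, \<open>P\<^sub>t\<close> becomes the polynomial with the simple roots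
  \<open>1, -1, \<omega>, -1/\<omega>\<close> where \<open>\<omega> = (t + \<i>) / (t - \<i>)\<close>, and biharmonic homogeneous polynomials of
  degree \<open>N\<close> are spanned by \<open>w ^ N, w ^ (N - 1), w, 1\<close>. Hence solving the problem in one degree
  amounts to interpolating at the four roots by these four monomials; the determinant involves
  only \<open>1 + \<omega>\<^sup>2\<close> and divisors \<open>\<omega> ^ n - 1\<close>, which the Diophantine condition bounds below by a multiple
  of \<open>1/n\<close>. Inverting the bilaplacian gains \<open>1/m\<^sup>2\<close>, so the solution operator in degree \<open>m\<close> has norm
  \<open>O(1/m)\<close>. The degree-by-degree recursion for \<open>u - g\<close> therefore has a unique solution, whose
  series converges on all of \<open>B\<^sub>R\<close>; that is, \<open>r = R\<close> works.
\<close>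

section \<open>Homogeneous parts as polynomials in one variable\<close>

text \<open>The l1 norm of the coefficients is used because it is submultiplicative, which Cauchy
  products need, and still dominates the values on the unit circle.\<close>

definition pnorm :: "complex poly \<Rightarrow> real" where
  "pnorm p = (\<Sum>c\<leftarrow>coeffs p. norm c)"

lemma pnorm_0 [simp]: "pnorm 0 = 0"
  by (simp add: pnorm_def)

lemma pnorm_pCons [simp]: "pnorm (pCons a p) = norm a + pnorm p"
  by (auto simp: pnorm_def coeffs_pCons_eq_cCons cCons_def)

lemma pnorm_nonneg [simp]: "0 \<le> pnorm p"
  by (induction p) auto

lemma pnorm_eq_sum: "degree p \<le> n \<Longrightarrow> pnorm p = (\<Sum>j\<le>n. norm (coeff p j))"
proof (induction p arbitrary: n)
  case (pCons a p)
  show ?case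
  proof (cases n)
    case 0
    then have "p = 0" using pCons.prems by (auto split: if_splits)
    then show ?thesis using 0 by simp
  next
    case (Suc k)
    then have "degree p \<le> k" using pCons.prems by (auto split: if_splits)
    then show ?thesis using pCons.IH[of k] Suc
      by (simp add: sum.atMost_Suc_shift del: sum.atMost_Suc)
  qed
qed simp

lemma pnorm_smult [simp]: "pnorm (smult c p) = norm c * pnorm p"
  by (induction p) (auto simp: norm_mult algebra_simps)

lemma pnorm_uminus [simp]: "pnorm (- p) = pnorm p"
  by (induction p) auto

lemma pnorm_add: "pnorm (p + q) \<le> pnorm p + pnorm q"
proof -
  define n where "n = max (degree p) (degree q)"
  have "degree p \<le> n" "degree q \<le> n" "degree (p + q) \<le> n"
    by (auto simp: n_def degree_add_le_max)
  then show ?thesis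
    by (simp add: pnorm_eq_sum[of _ n] sum.distrib[symmetric] sum_mono norm_triangle_ineq)
qed

lemma pnorm_diff: "pnorm (p - q) \<le> pnorm p + pnorm q"
  using pnorm_add[of p "- q"] by simp

lemma pnorm_mult: "pnorm (p * q) \<le> pnorm p * pnorm q"
proof (induction p)
  case (pCons a p)
  have "pnorm (pCons a p * q) \<le> norm a * pnorm q + pnorm (p * q)"
    using pnorm_add[of "smult a q" "pCons 0 (p * q)"] by simp
  then show ?case using pCons.IH by (simp add: algebra_simps)
qed simp

lemma pnorm_sum: "pnorm (sum f A) \<le> (\<Sum>i\<in>A. pnorm (f i))"
  by (induction A rule: infinite_finite_induct) (auto intro: order_trans[OF pnorm_add])

lemma pnorm_monom [simp]: "pnorm (monom c n) = norm c"
  by (induction n) (auto simp: monom_0 monom_Suc)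

lemma norm_poly_le_pnorm: "norm z = 1 \<Longrightarrow> norm (poly p z) \<le> pnorm p"
proof (induction p)
  case (pCons a p)
  then show ?case
    using norm_triangle_ineq[of a "z * poly p z"] by (simp add: norm_mult)
qed simp

lemma pnorm_pderiv: "degree p \<le> n \<Longrightarrow> pnorm (pderiv p) \<le> real n * pnorm p"
proof (cases n)
  case (Suc k)
  assume n: "degree p \<le> n"
  then have "pnorm (pderiv p) = (\<Sum>j\<le>k. real (Suc j) * norm (coeff p (Suc j)))"
    using Suc by (subst pnorm_eq_sum[of _ k])
      (auto simp: degree_pderiv coeff_pderiv norm_mult simp del: of_nat_Suc)
  also have "\<dots> \<le> (\<Sum>j\<le>k. real n * norm (coeff p (Suc j)))"
    using Suc by (intro sum_mono mult_right_mono) auto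
  also have "\<dots> \<le> (\<Sum>j\<le>n. real n * norm (coeff p j))"
    unfolding Suc sum.atMost_Suc_shift[of _ k] by simp
  finally show ?thesis by (simp add: pnorm_eq_sum[OF n] sum_distrib_left)
qed (use pderiv_eq_0_iff[of p] in auto)

text \<open>Cauchy's estimate for the \<open>n\<close>-th derivative at 0 on the unit disc; that
  derivative is \<open>fact n\<close> times the coefficient.\<close>

lemma norm_coeff_le_sup_unit_circle:
  fixes p :: "complex poly"
  assumes "\<And>w. norm w = 1 \<Longrightarrow> norm (poly p w) \<le> B"
  shows "norm (coeff p n) \<le> B"
proof -
  have hd: "(deriv ^^ n) (poly p) = poly ((pderiv ^^ n) p)" for p :: "complex poly"
  proof (induction n arbitrary: p)
    case (Suc n)
    have "deriv (poly p) = poly (pderiv p)"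
      by (intro ext DERIV_imp_deriv poly_DERIV)
    then show ?case using Suc[of "pderiv p"] by (simp only: funpow_Suc_right o_apply)
  qed simp
  have c: "coeff ((pderiv ^^ n) p) 0 = fact n * coeff p n" for p :: "complex poly"
  proof (induction n arbitrary: p)
    case (Suc n)
    then show ?case by (simp add: funpow_Suc_right coeff_pderiv algebra_simps del: funpow.simps(2))
  qed simp
  have "norm ((deriv ^^ n) (poly p) 0) \<le> fact n * B / 1 ^ n"
    by (rule Cauchy_inequality) (auto intro!: assms holomorphic_intros continuous_intros)
  then show ?thesis by (simp add: hd poly_0_coeff_0 c norm_mult)
qed

text \<open>The degree \<open>m\<close> is a separate argument because \<open>p\<close> alone does
  not determine it. Written out as a sum instead of \<open>cnj z ^ m * poly p (z / cnj z)\<close>,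
  the form also has the right value at the origin.\<close>

definition hpoly :: "nat \<Rightarrow> complex poly \<Rightarrow> complex \<Rightarrow> complex" where
  "hpoly m p z = (\<Sum>j\<le>m. coeff p j * z ^ j * cnj z ^ (m - j))"

lemma hpoly_add: "hpoly m (p + q) z = hpoly m p z + hpoly m q z"
  by (simp add: hpoly_def sum.distrib algebra_simps)

lemma hpoly_diff: "hpoly m (p - q) z = hpoly m p z - hpoly m q z"
  by (simp add: hpoly_def sum_subtractf algebra_simps)

lemma hpoly_smult: "hpoly m (smult c p) z = c * hpoly m p z"
  by (simp add: hpoly_def sum_distrib_left mult.assoc)

lemma hpoly_0 [simp]: "hpoly m 0 z = 0"
  by (simp add: hpoly_def)

lemma hpoly_sum: "hpoly m (sum f A) z = (\<Sum>i\<in>A. hpoly m (f i) z)"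
  by (induction A rule: infinite_finite_induct) (auto simp: hpoly_add)

lemma hpoly_eq_poly:
  assumes "degree p \<le> m" "z \<noteq> 0"
  shows "hpoly m p z = cnj z ^ m * poly p (z / cnj z)"
proof -
  have "poly p (z / cnj z) = (\<Sum>j\<le>m. coeff p j * (z / cnj z) ^ j)"
    unfolding poly_altdef using assms
    by (intro sum.mono_neutral_left) (auto simp: coeff_eq_0)
  then show ?thesis using assms(2)
    by (simp only: hpoly_def sum_distrib_left)
      (auto simp: power_diff power_divide intro!: sum.cong)
qed

text \<open>Away from the origin both sides are evaluations at \<open>z / cnj z\<close>. At the
  origin that quotient is useless, and only the constant terms in degree 0 survive.\<close>

lemma hpoly_mult:
  assumes "degree p \<le> m" "degree q \<le> n"
  shows "hpoly (m + n) (p * q) z = hpoly m p z * hpoly n q z"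
proof (cases "z = 0")
  case True
  have *: "hpoly k r 0 = (if k = 0 then coeff r 0 else 0)" for k r
    unfolding hpoly_def
    by (cases "k = 0", simp, subst sum.neutral) (auto simp: power_0_left)
  show ?thesis by (simp add: True * coeff_mult)
next
  case False
  moreover have "degree (p * q) \<le> m + n"
    using assms degree_mult_le[of p q] by linarith
  ultimately show ?thesis using assms by (simp add: hpoly_eq_poly power_add)
qed

lemma norm_hpoly_le:
  assumes "degree p \<le> m"
  shows "norm (hpoly m p z) \<le> pnorm p * norm z ^ m"
proof -
  have "norm (hpoly m p z) \<le> (\<Sum>j\<le>m. norm (coeff p j) * norm z ^ m)"
    unfolding hpoly_def
    by (intro sum_norm_le) (auto simp: norm_mult norm_power mult.assoc simp flip: power_add)
  then show ?thesis by (simp add: pnorm_eq_sum[OF assms] sum_distrib_right)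
qed

text \<open>The quotient \<open>z / cnj z\<close> doubles the argument, so a point with half the
  argument of \<open>w\<close> and the prescribed modulus works.\<close>

lemma unit_circle_eq_quotient:
  assumes "norm w = 1" "\<rho> > 0"
  obtains z where "norm z = \<rho>" "z / cnj z = w"
proof -
  obtain a where a: "w = cis a" using assms(1) by (metis cis_Arg norm_zero sgn_eq zero_neq_one div_by_1 of_real_1)
  define z where "z = of_real \<rho> * cis (a / 2)"
  have "z / cnj z = w" using assms(2)
    by (simp add: z_def a cis_cnj cis_divide)
  moreover have "norm z = \<rho>" using assms(2) by (simp add: z_def norm_mult)
  ultimately show ?thesis using that by blast
qed

text \<open>On a circle about 0 the quotient \<open>z / cnj z\<close> runs through the whole unit
  circle, so a bound for the form yields a bound for \<open>p\<close> there, and Cauchy's estimate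
  applies.\<close>

lemma norm_coeff_le_sup_hpoly:
  assumes "degree p \<le> m" "\<rho> > 0" "\<And>z. norm z = \<rho> \<Longrightarrow> norm (hpoly m p z) \<le> B"
  shows "norm (coeff p j) * \<rho> ^ m \<le> B"
proof -
  have "norm (poly p w) \<le> B / \<rho> ^ m" if w: "norm w = 1" for w
  proof -
    obtain z where z: "norm z = \<rho>" "z / cnj z = w"
      using unit_circle_eq_quotient[OF w \<open>\<rho> > 0\<close>] .
    have "norm (hpoly m p z) = \<rho> ^ m * norm (poly p w)"
      using z assms(2) by (subst hpoly_eq_poly[OF assms(1)]) (auto simp: norm_mult norm_power)
    then show ?thesis using assms(3)[OF z(1)] assms(2) by (simp add: field_simps)
  qed
  then have "norm (coeff p j) \<le> B / \<rho> ^ m" by (rule norm_coeff_le_sup_unit_circle)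
  then show ?thesis using assms(2) by (simp add: field_simps)
qed

lemma hpoly_cancel:
  assumes "degree p \<le> m" "degree q \<le> m" "\<And>z. hpoly m p z = hpoly m q z"
  shows "p = q"
proof -
  have "norm (coeff (p - q) j) * 1 ^ m \<le> 0" for j
    by (rule norm_coeff_le_sup_hpoly)
      (use assms in \<open>auto simp: hpoly_diff intro: degree_diff_le\<close>)
  then show ?thesis by (auto simp: poly_eq_iff)
qed

text \<open>The derivative in \<open>cnj z\<close> of a form of degree \<open>m\<close>, acting on
  its one-variable polynomial; the derivative in \<open>z\<close> is simply \<open>pderiv\<close>.
  Both lower the degree of the form by one.\<close>

definition dbar :: "nat \<Rightarrow> complex poly \<Rightarrow> complex poly" where
  "dbar m p = smult (of_nat m) p - pCons 0 (pderiv p)"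

lemma coeff_dbar: "coeff (dbar m p) j = (of_nat m - of_nat j) * coeff p j"
  by (cases j) (auto simp: dbar_def coeff_pderiv coeff_pCons algebra_simps)

lemma degree_dbar: "degree p \<le> Suc m \<Longrightarrow> degree (dbar (Suc m) p) \<le> m"
proof (rule degree_le, intro allI impI)
  fix i assume "degree p \<le> Suc m" "m < i"
  then have "i = Suc m \<or> degree p < i" by linarith
  then show "coeff (dbar (Suc m) p) i = 0" by (auto simp: coeff_dbar coeff_eq_0)
qed

lemma pnorm_dbar: "degree p \<le> n \<Longrightarrow> pnorm (dbar n p) \<le> 2 * real n * pnorm p"
  using pnorm_diff[of "smult (of_nat n) p" "pCons 0 (pderiv p)"] pnorm_pderiv[of p n]
  by (simp add: dbar_def)

lemma hpoly_pderiv: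
  "hpoly m (pderiv p) z = (\<Sum>j\<le>Suc m. coeff p j * of_nat j * z ^ (j - 1) * cnj z ^ (Suc m - j))"
  unfolding sum.atMost_Suc_shift[of _ m] by (simp add: hpoly_def coeff_pderiv algebra_simps)

lemma hpoly_dbar:
  "hpoly m (dbar (Suc m) p) z = (\<Sum>j\<le>Suc m. coeff p j * of_nat (Suc m - j) * z ^ j * cnj z ^ (m - j))"
  unfolding sum.atMost_Suc[of _ m]
  by (auto simp: hpoly_def coeff_dbar algebra_simps of_nat_diff intro!: sum.cong)

text \<open>Real differentiability with the two Wirtinger derivatives as coefficients of
  \<open>h\<close> and \<open>cnj h\<close>. Starting from degree \<open>Suc m\<close> avoids a
  truncated \<open>m - 1\<close> for the degree of the derivatives.\<close>

lemma has_derivative_hpoly_Suc: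
  "(hpoly (Suc m) p has_derivative
     (\<lambda>h. hpoly m (pderiv p) z * h + hpoly m (dbar (Suc m) p) z * cnj h)) (at z within S)"
proof -
  have 1: "((\<lambda>z. z ^ j * cnj z ^ k) has_derivative
     (\<lambda>h. of_nat j * z ^ (j - 1) * cnj z ^ k * h + of_nat k * z ^ j * cnj z ^ (k - 1) * cnj h))
     (at z within S)" for j k
    by (auto intro!: derivative_eq_intros simp: algebra_simps)
  have "(hpoly (Suc m) p has_derivative
     (\<lambda>h. \<Sum>j\<le>Suc m. coeff p j * (of_nat j * z ^ (j - 1) * cnj z ^ (Suc m - j) * h
        + of_nat (Suc m - j) * z ^ j * cnj z ^ (Suc m - j - 1) * cnj h))) (at z within S)"
    unfolding hpoly_def[abs_def] mult.assoc[of "coeff _ _"]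
    by (intro has_derivative_sum has_derivative_mult_right 1)
  also have "(\<lambda>h. \<Sum>j\<le>Suc m. coeff p j * (of_nat j * z ^ (j - 1) * cnj z ^ (Suc m - j) * h
        + of_nat (Suc m - j) * z ^ j * cnj z ^ (Suc m - j - 1) * cnj h))
      = (\<lambda>h. hpoly m (pderiv p) z * h + hpoly m (dbar (Suc m) p) z * cnj h)"
    unfolding hpoly_pderiv hpoly_dbar
    by (simp only: sum_distrib_right sum_distrib_left sum.distrib[symmetric] distrib_left mult_ac diff_Suc_1
          diff_commute[of "Suc m" _ 1])
  finally show ?thesis .
qed

text \<open>Euler's identity for homogeneous functions in Wirtinger form: the weights
  \<open>j\<close> and \<open>Suc m - j\<close> add up to the degree. It drives the induction in
  \<open>taylor_coeff_sum\<close>.\<close>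

lemma hpoly_Euler:
  "z * hpoly m (pderiv p) z + cnj z * hpoly m (dbar (Suc m) p) z = of_nat (Suc m) * hpoly (Suc m) p z"
proof -
  have "z * (coeff p j * of_nat j * z ^ (j - 1) * cnj z ^ (Suc m - j))
      + cnj z * (coeff p j * of_nat (Suc m - j) * z ^ j * cnj z ^ (m - j))
      = of_nat (Suc m) * (coeff p j * z ^ j * cnj z ^ (Suc m - j))" if "j \<le> Suc m" for j
  proof -
    have a: "of_nat j * (z * z ^ (j - 1)) = of_nat j * z ^ j" by (cases j) auto
    have b: "of_nat (Suc m - j) * (cnj z * cnj z ^ (m - j)) = of_nat (Suc m - j) * cnj z ^ (Suc m - j)"
      using that by (cases "j = Suc m") (auto simp: Suc_diff_le)
    have "z * (coeff p j * of_nat j * z ^ (j - 1) * cnj z ^ (Suc m - j))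
      + cnj z * (coeff p j * of_nat (Suc m - j) * z ^ j * cnj z ^ (m - j))
      = coeff p j * cnj z ^ (Suc m - j) * (of_nat j * (z * z ^ (j - 1))) +
        coeff p j * z ^ j * (of_nat (Suc m - j) * (cnj z * cnj z ^ (m - j)))"
      by (simp only: mult_ac)
    also have "\<dots> = (of_nat j + of_nat (Suc m - j)) * (coeff p j * z ^ j * cnj z ^ (Suc m - j))"
      unfolding a b by (simp only: ring_distribs mult_ac)
    finally show ?thesis using that by (simp flip: of_nat_add)
  qed
  then show ?thesis
    unfolding hpoly_pderiv hpoly_dbar sum_distrib_left sum.distrib[symmetric]
    by (simp only: hpoly_def sum_distrib_left) (rule sum.cong, auto simp del: of_nat_Suc of_nat_diff)
qed

section \<open>Series of homogeneous polynomials\<close>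

definition to_complex :: "real \<times> real \<Rightarrow> complex" where
  "to_complex p = Complex (fst p) (snd p)"

lemma to_complex_eq: "to_complex p = of_real (fst p) + \<i> * of_real (snd p)"
  by (simp add: to_complex_def complex_eq_iff)

lemma to_complex_Pair: "to_complex (x, y) = of_real x + \<i> * of_real y"
  by (simp add: to_complex_eq)

lemma bounded_linear_to_complex: "bounded_linear to_complex"
  unfolding to_complex_eq[abs_def]
  by (intro bounded_linear_add bounded_linear_const_mult
      bounded_linear_compose[OF bounded_linear_of_real] bounded_linear_fst bounded_linear_snd)

lemma continuous_on_to_complex: "continuous_on S to_complex"
  using bounded_linear_to_complex by (rule linear_continuous_on)

lemma to_complex_0 [simp]: "to_complex (0, 0) = 0"
  by (simp add: to_complex_Pair)

lemma surj_to_complex: "\<exists>p. to_complex p = z"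
  by (intro exI[of _ "(Re z, Im z)"]) (simp add: to_complex_def)

lemma mem_disc_iff: "p \<in> disc R \<longleftrightarrow> ereal (norm (to_complex p)) < R"
  by (cases p) (simp add: disc_def to_complex_def complex_norm)

lemma open_disc: "open (disc R)"
proof -
  have "open {z::complex. ereal (norm z) < R}"
    by (intro open_Collect_less continuous_intros)
  then have "open (to_complex -` {z. ereal (norm z) < R})"
    by (intro open_vimage continuous_on_to_complex)
  also have "to_complex -` {z. ereal (norm z) < R} = disc R"
    by (auto simp: mem_disc_iff)
  finally show ?thesis .
qed

section \<open>Coefficient growth and convergence at all radii below \<open>R\<close>\<close>

lemma ereal_between_pos:
  assumes "ereal x < R" "0 \<le> x"
  obtains \<rho> where "x < \<rho>" "0 < \<rho>" "ereal \<rho> < R"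
proof -
  obtain \<rho> where "ereal x < ereal \<rho>" "ereal \<rho> < R" using ereal_dense2[OF assms(1)] by auto
  then show ?thesis using that assms(2) by auto
qed

definition summable_below :: "ereal \<Rightarrow> (nat \<Rightarrow> real) \<Rightarrow> bool" where
  "summable_below R \<alpha> \<longleftrightarrow> (\<forall>\<rho>. 0 < \<rho> \<longrightarrow> ereal \<rho> < R \<longrightarrow> summable (\<lambda>m. \<alpha> m * \<rho> ^ m))"

lemma summable_belowD: "summable_below R \<alpha> \<Longrightarrow> 0 < \<rho> \<Longrightarrow> ereal \<rho> < R \<Longrightarrow> summable (\<lambda>m. \<alpha> m * \<rho> ^ m)"
  by (auto simp: summable_below_def)

lemma summable_below_mono:
  assumes "summable_below R \<alpha>" "\<And>m. 0 \<le> \<beta> m" "\<And>m. \<beta> m \<le> \<alpha> m"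
  shows "summable_below R \<beta>"
  unfolding summable_below_def
proof (intro allI impI)
  fix \<rho> :: real assume \<rho>: "0 < \<rho>" "ereal \<rho> < R"
  show "summable (\<lambda>m. \<beta> m * \<rho> ^ m)"
    by (rule summable_comparison_test[OF _ summable_belowD[OF assms(1) \<rho>]])
      (use assms(2,3) \<rho> in \<open>auto intro!: mult_right_mono exI[of _ 0]\<close>)
qed

lemma summable_below_cmult: "summable_below R \<alpha> \<Longrightarrow> summable_below R (\<lambda>m. C * \<alpha> m)"
  by (auto simp: summable_below_def mult.assoc intro!: summable_mult)

lemma summable_below_add: "summable_below R \<alpha> \<Longrightarrow> summable_below R \<beta> \<Longrightarrow> summable_below R (\<lambda>m. \<alpha> m + \<beta> m)"
  by (auto simp: summable_below_def distrib_right intro!: summable_add)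

lemma summable_below_shift:
  assumes "summable_below R \<alpha>"
  shows "summable_below R (\<lambda>m. \<alpha> (m + l))"
  unfolding summable_below_def
proof (intro allI impI)
  fix \<rho> :: real assume \<rho>: "0 < \<rho>" "ereal \<rho> < R"
  have "summable (\<lambda>m. inverse (\<rho> ^ l) * (\<alpha> (m + l) * \<rho> ^ (m + l)))"
    by (intro summable_mult summable_ignore_initial_segment[OF summable_belowD[OF assms \<rho>]])
  then show "summable (\<lambda>m. \<alpha> (m + l) * \<rho> ^ m)"
    using \<rho>(1) by (simp add: power_add field_simps)
qed

text \<open>Abel's lemma: passing to a slightly larger radius leaves a geometric factor, which
  absorbs linear growth. Linear growth is allowed because a form of degree \<open>m\<close> has
  \<open>m + 1\<close> coefficients, which \<open>A_alg_imp_expands\<close> bounds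
  separately.\<close>

lemma summable_below_of_bounded_terms:
  assumes "\<And>\<rho>. 0 < \<rho> \<Longrightarrow> ereal \<rho> < R \<Longrightarrow> \<exists>M. \<forall>m\<ge>M. norm (\<alpha> m * \<rho> ^ m) \<le> real (m + 1)"
  shows "summable_below R \<alpha>"
  unfolding summable_below_def
proof (intro allI impI)
  fix \<rho> :: real assume \<rho>: "0 < \<rho>" "ereal \<rho> < R"
  obtain \<sigma> where \<sigma>: "\<rho> < \<sigma>" "0 < \<sigma>" "ereal \<sigma> < R"
    using ereal_between_pos[OF \<rho>(2)] \<rho>(1) by auto
  obtain M where M: "\<And>m. m \<ge> M \<Longrightarrow> norm (\<alpha> m * \<sigma> ^ m) \<le> real (m + 1)"
    using assms[OF \<sigma>(2,3)] by blast
  define x where "x = \<rho> / \<sigma>"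
  have x: "0 < x" "x < 1" using \<rho> \<sigma> by (auto simp: x_def)
  have "summable (\<lambda>m. real (m + 1) * x ^ m)"
    using sums_summable[OF geometric_deriv_sums[of x]] x by simp
  then show "summable (\<lambda>m. \<alpha> m * \<rho> ^ m)"
  proof (rule summable_comparison_test[rotated], intro exI[of _ M] allI impI)
    fix m assume "m \<ge> M"
    have "norm (\<alpha> m * \<rho> ^ m) = norm (\<alpha> m * \<sigma> ^ m) * x ^ m"
      using \<sigma> \<rho> by (simp add: x_def power_divide abs_mult)
    also have "\<dots> \<le> real (m + 1) * x ^ m"
      using M[OF \<open>m \<ge> M\<close>] x by (intro mult_right_mono) auto
    finally show "norm (\<alpha> m * \<rho> ^ m) \<le> real (m + 1) * x ^ m" .
  qed
qed

text \<open>Convergent series have null terms, so at each radius the weighted terms are eventually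
  at most \<open>m + 1\<close>, and Abel's lemma applies without shrinking \<open>R\<close>.\<close>

lemma summable_below_weight_1:
  assumes "summable_below R \<alpha>"
  shows "summable_below R (\<lambda>m. real (m + 1) * \<alpha> m)"
proof (rule summable_below_of_bounded_terms)
  fix \<rho> :: real assume \<rho>: "0 < \<rho>" "ereal \<rho> < R"
  have "(\<lambda>m. \<alpha> m * \<rho> ^ m) \<longlonglongrightarrow> 0"
    by (rule summable_LIMSEQ_zero[OF summable_belowD[OF assms \<rho>]])
  then obtain M where M: "\<And>m. m \<ge> M \<Longrightarrow> norm (\<alpha> m * \<rho> ^ m) < 1"
    using LIMSEQ_D[of _ 0 1] by fastforce
  have "norm (real (m + 1) * \<alpha> m * \<rho> ^ m) \<le> real (m + 1)" if "m \<ge> M" for m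
    using mult_left_mono[OF less_imp_le[OF M[OF that]], of "real (m + 1)"]
    by (simp add: abs_mult mult.assoc)
  then show "\<exists>M. \<forall>m\<ge>M. norm (real (m + 1) * \<alpha> m * \<rho> ^ m) \<le> real (m + 1)" by blast
qed

lemma summable_below_weight: "summable_below R \<alpha> \<Longrightarrow> summable_below R (\<lambda>m. real (m + 1) ^ k * \<alpha> m)"
proof (induction k)
  case (Suc k)
  from summable_below_weight_1[OF Suc.IH[OF Suc.prems]] show ?case by (simp add: mult.assoc)
qed simp

text \<open>The degree condition guarantees that \<open>hpoly m (a m)\<close> sees every coefficient
  of \<open>a m\<close>.\<close>

definition conv_coeffs :: "ereal \<Rightarrow> (nat \<Rightarrow> complex poly) \<Rightarrow> bool" where
  "conv_coeffs R a \<longleftrightarrow> (\<forall>m. degree (a m) \<le> m) \<and> summable_below R (\<lambda>m. pnorm (a m))"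

lemma conv_coeffs_degree: "conv_coeffs R a \<Longrightarrow> degree (a m) \<le> m"
  by (simp add: conv_coeffs_def)

lemma conv_coeffs_summable_below: "conv_coeffs R a \<Longrightarrow> summable_below R (\<lambda>m. pnorm (a m))"
  by (simp add: conv_coeffs_def)

definition hser :: "(nat \<Rightarrow> complex poly) \<Rightarrow> complex \<Rightarrow> complex" where
  "hser a z = (\<Sum>m. hpoly m (a m) z)"

lemma norm_hpoly_le':
  assumes "degree p \<le> m" "norm z \<le> \<rho>"
  shows "norm (hpoly m p z) \<le> pnorm p * \<rho> ^ m"
  by (rule order_trans[OF norm_hpoly_le[OF assms(1)]])
    (intro mult_left_mono power_mono assms, auto)

lemma summable_norm_hpoly:
  assumes "conv_coeffs R a" "ereal (norm z) < R"
  shows "summable (\<lambda>m. norm (hpoly m (a m) z))"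
proof -
  obtain \<rho> where \<rho>: "norm z < \<rho>" "0 < \<rho>" "ereal \<rho> < R"
    using ereal_between_pos[OF assms(2)] by auto
  show ?thesis
    by (rule summable_comparison_test[OF _ summable_belowD[OF conv_coeffs_summable_below[OF assms(1)] \<rho>(2,3)]])
      (use \<rho> in \<open>auto intro!: norm_hpoly_le' conv_coeffs_degree[OF assms(1)]\<close>)
qed

lemma hser_sums:
  assumes "conv_coeffs R a" "ereal (norm z) < R"
  shows "(\<lambda>m. hpoly m (a m) z) sums hser a z"
  unfolding hser_def
  using summable_norm_cancel[OF summable_norm_hpoly[OF assms]] by (rule summable_sums)

lemma uniform_limit_hser:
  assumes "conv_coeffs R a" "0 < \<rho>" "ereal \<rho> < R" "\<And>z. z \<in> S \<Longrightarrow> norm z \<le> \<rho>"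
  shows "uniform_limit S (\<lambda>n z. \<Sum>m<n. hpoly m (a m) z) (hser a) sequentially"
  unfolding hser_def
  by (rule Weierstrass_m_test[OF _ summable_belowD[OF conv_coeffs_summable_below[OF assms(1)] assms(2,3)]])
    (auto intro!: norm_hpoly_le' conv_coeffs_degree[OF assms(1)] assms)

lemma hser_0: "hser a 0 = coeff (a 0) 0"
proof -
  have "hpoly m (a m) 0 = 0" if "m \<noteq> 0" for m
    unfolding hpoly_def using that by (intro sum.neutral) (auto simp: power_0_left)
  then have "hser a 0 = (\<Sum>m\<in>{0}. hpoly m (a m) 0)"
    unfolding hser_def by (intro suminf_finite) auto
  then show ?thesis by (simp add: hpoly_def)
qed

section \<open>Termwise differentiation\<close>

definition dz :: "(nat \<Rightarrow> complex poly) \<Rightarrow> nat \<Rightarrow> complex poly" where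
  "dz a m = pderiv (a (Suc m))"

definition dzb :: "(nat \<Rightarrow> complex poly) \<Rightarrow> nat \<Rightarrow> complex poly" where
  "dzb a m = dbar (Suc m) (a (Suc m))"

text \<open>The degree \<open>m\<close> part of a derivative comes from degree \<open>Suc m\<close>.
  Differentiation costs a factor \<open>Suc m\<close>, which summability at all radii below
  \<open>R\<close> absorbs.\<close>

lemma conv_coeffs_dz:
  assumes "conv_coeffs R a" shows "conv_coeffs R (dz a)"
  unfolding conv_coeffs_def
proof
  show "\<forall>m. degree (dz a m) \<le> m"
  proof
    fix m
    show "degree (dz a m) \<le> m"
      using conv_coeffs_degree[OF assms, of "Suc m"] unfolding dz_def degree_pderiv by linarith
  qed
  have "summable_below R (\<lambda>m. real (m + 1 + 1) * pnorm (a (m + 1)))"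
    by (rule summable_below_shift[OF summable_below_weight_1[OF conv_coeffs_summable_below[OF assms]]])
  then show "summable_below R (\<lambda>m. pnorm (dz a m))"
  proof (rule summable_below_mono)
    fix m
    have "pnorm (dz a m) \<le> real (Suc m) * pnorm (a (Suc m))"
      unfolding dz_def by (rule pnorm_pderiv[OF conv_coeffs_degree[OF assms]])
    also have "\<dots> \<le> real (m + 1 + 1) * pnorm (a (m + 1))"
      by (simp add: mult_right_mono)
    finally show "pnorm (dz a m) \<le> real (m + 1 + 1) * pnorm (a (m + 1))" .
  qed simp
qed

lemma conv_coeffs_dzb:
  assumes "conv_coeffs R a" shows "conv_coeffs R (dzb a)"
  unfolding conv_coeffs_def
proof
  show "\<forall>m. degree (dzb a m) \<le> m"
    by (auto simp: dzb_def intro: degree_dbar conv_coeffs_degree[OF assms])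
  have "summable_below R (\<lambda>m. 2 * (real (m + 1 + 1) * pnorm (a (m + 1))))"
    by (rule summable_below_cmult[OF summable_below_shift[OF summable_below_weight_1[OF conv_coeffs_summable_below[OF assms]]]])
  then show "summable_below R (\<lambda>m. pnorm (dzb a m))"
  proof (rule summable_below_mono)
    fix m
    have "pnorm (dzb a m) \<le> 2 * real (Suc m) * pnorm (a (Suc m))"
      unfolding dzb_def by (rule pnorm_dbar[OF conv_coeffs_degree[OF assms]])
    also have "\<dots> \<le> 2 * (real (m + 1 + 1) * pnorm (a (m + 1)))"
      by (simp add: algebra_simps)
    finally show "pnorm (dzb a m) \<le> 2 * (real (m + 1 + 1) * pnorm (a (m + 1)))" .
  qed simp
qed

lemma conv_coeffs_add:
  assumes "conv_coeffs R a" "conv_coeffs R b"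
  shows "conv_coeffs R (\<lambda>m. a m + b m)"
  unfolding conv_coeffs_def
  using summable_below_mono[OF summable_below_add[OF assms[THEN conv_coeffs_summable_below]] pnorm_nonneg pnorm_add]
    conv_coeffs_degree[OF assms(1)] conv_coeffs_degree[OF assms(2)]
  by (auto intro: degree_add_le)

lemma conv_coeffs_smult:
  assumes "conv_coeffs R a"
  shows "conv_coeffs R (\<lambda>m. smult c (a m))"
  unfolding conv_coeffs_def
  using summable_below_cmult[OF conv_coeffs_summable_below[OF assms], of "norm c"] conv_coeffs_degree[OF assms]
  by (auto intro: order_trans[OF degree_smult_le])

lemma conv_coeffs_diff:
  assumes "conv_coeffs R a" "conv_coeffs R b"
  shows "conv_coeffs R (\<lambda>m. a m - b m)"
  using conv_coeffs_add[OF assms(1) conv_coeffs_smult[OF assms(2), of "-1"]] by simp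

lemma hser_add:
  assumes "conv_coeffs R a" "conv_coeffs R b" "ereal (norm z) < R"
  shows "hser (\<lambda>m. a m + b m) z = hser a z + hser b z"
  using sums_add[OF hser_sums[OF assms(1,3)] hser_sums[OF assms(2,3)]]
  by (simp add: sums_iff hser_def hpoly_add)

lemma hser_smult:
  assumes "conv_coeffs R a" "ereal (norm z) < R"
  shows "hser (\<lambda>m. smult c (a m)) z = c * hser a z"
  using sums_mult[OF hser_sums[OF assms], of c]
  by (simp add: sums_iff hser_def hpoly_smult)

lemma hser_diff:
  assumes "conv_coeffs R a" "conv_coeffs R b" "ereal (norm z) < R"
  shows "hser (\<lambda>m. a m - b m) z = hser a z - hser b z"
  using sums_diff[OF hser_sums[OF assms(1,3)] hser_sums[OF assms(2,3)]]
  by (simp add: sums_iff hser_def hpoly_diff)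

text \<open>Termwise differentiation on a ball of radius \<open>\<rho>\<close> below
  \<open>R\<close>, where the series of both Wirtinger derivatives converge uniformly.\<close>

lemma hser_has_derivative:
  assumes a: "conv_coeffs R a" and z: "ereal (norm z) < R"
  shows "(hser a has_derivative (\<lambda>h. hser (dz a) z * h + hser (dzb a) z * cnj h)) (at z)"
proof -
  obtain \<rho> where \<rho>: "norm z < \<rho>" "0 < \<rho>" "ereal \<rho> < R"
    using ereal_between_pos[OF z] by auto
  define S where "S = ball (0::complex) \<rho>"
  have lt: "ereal (norm w) < R" if "w \<in> S" for w
    using that \<rho> by (simp add: S_def) (meson ereal_less_eq(3) less_imp_le order_le_less_trans)
  have U: "uniform_limit S (\<lambda>n z. \<Sum>m<n. hpoly m (b m) z) (hser b) sequentially"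
    if "conv_coeffs R b" for b
    by (rule uniform_limit_hser[OF that \<rho>(2,3)]) (auto simp: S_def)
  \<comment> \<open>The derivative formula starts in degree 1, so the constant term is split off
    here and added back at the end.\<close>
  have tail: "(\<lambda>m. hpoly (Suc m) (a (Suc m)) w) sums (hser a w - hpoly 0 (a 0) w)"
    if "w \<in> S" for w
    using sums_split_initial_segment[OF hser_sums[OF a lt[OF that]], of 1] by simp
  have "\<exists>g. \<forall>x\<in>S. (\<lambda>n. hpoly (Suc n) (a (Suc n)) x) sums g x \<and>
      (g has_derivative (\<lambda>h. hser (dz a) x * h + hser (dzb a) x * cnj h)) (at x within S)"
  proof (rule has_derivative_series)
    show "convex S" "z \<in> S" using \<rho> by (auto simp: S_def)
    show "(hpoly (Suc n) (a (Suc n)) has_derivative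
        (\<lambda>h. hpoly n (dz a n) x * h + hpoly n (dzb a n) x * cnj h)) (at x within S)" for n x
      unfolding dz_def dzb_def by (rule has_derivative_hpoly_Suc)
    show "(\<lambda>n. hpoly (Suc n) (a (Suc n)) z) sums (hser a z - hpoly 0 (a 0) z)"
      using \<rho> by (intro tail) (auto simp: S_def)
    fix e :: real assume "e > 0"
    \<comment> \<open>Half of \<open>e\<close> for each Wirtinger part, since \<open>cnj h\<close>
      has the same norm as \<open>h\<close>.\<close>
    then have "e / 2 > 0" by simp
    from uniform_limitD[OF U[OF conv_coeffs_dz[OF a]] this]
      uniform_limitD[OF U[OF conv_coeffs_dzb[OF a]] this]
    show "\<forall>\<^sub>F n in sequentially. \<forall>x\<in>S. \<forall>h. norm ((\<Sum>i<n. hpoly i (dz a i) x * h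
        + hpoly i (dzb a i) x * cnj h) - (hser (dz a) x * h + hser (dzb a) x * cnj h)) \<le> e * norm h"
    proof eventually_elim
      case (elim n)
      show ?case
      proof (intro ballI allI)
        fix x h assume "x \<in> S"
        define A B where "A = (\<Sum>i<n. hpoly i (dz a i) x) - hser (dz a) x"
          and "B = (\<Sum>i<n. hpoly i (dzb a i) x) - hser (dzb a) x"
        have AB: "norm A \<le> e / 2" "norm B \<le> e / 2"
          using bspec[OF elim(1) \<open>x \<in> S\<close>] bspec[OF elim(2) \<open>x \<in> S\<close>]
          unfolding A_def B_def dist_norm by linarith+
        have "(\<Sum>i<n. hpoly i (dz a i) x * h + hpoly i (dzb a i) x * cnj h)
            - (hser (dz a) x * h + hser (dzb a) x * cnj h) = A * h + B * cnj h"
          by (simp add: A_def B_def sum.distrib sum_distrib_left algebra_simps)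
        also have "norm \<dots> \<le> norm A * norm h + norm B * norm h"
          by (rule order_trans[OF norm_triangle_ineq]) (simp add: norm_mult)
        also have "\<dots> \<le> e / 2 * norm h + e / 2 * norm h"
          using AB by (intro add_mono mult_right_mono) auto
        finally show "norm ((\<Sum>i<n. hpoly i (dz a i) x * h + hpoly i (dzb a i) x * cnj h)
            - (hser (dz a) x * h + hser (dzb a) x * cnj h)) \<le> e * norm h" by simp
      qed
    qed
  qed
  then obtain g where g: "\<And>x. x \<in> S \<Longrightarrow> (\<lambda>n. hpoly (Suc n) (a (Suc n)) x) sums g x"
    "\<And>x. x \<in> S \<Longrightarrow> (g has_derivative (\<lambda>h. hser (dz a) x * h + hser (dzb a) x * cnj h)) (at x within S)"
    by blast
  have zS: "z \<in> S" "open S" using \<rho> by (auto simp: S_def)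
  have "((\<lambda>x. coeff (a 0) 0 + g x) has_derivative (\<lambda>h. 0 + (hser (dz a) z * h + hser (dzb a) z * cnj h))) (at z)"
    by (intro has_derivative_add has_derivative_const g(2)[OF zS(1), unfolded at_within_open[OF zS]])
  moreover have "coeff (a 0) 0 + g x = hser a x" if "x \<in> S" for x
    using sums_unique2[OF g(1)[OF that] tail[OF that]] by (simp add: hpoly_def)
  ultimately show ?thesis
    using has_derivative_transform_within_open[OF _ zS(2,1)] by (simp only: add_0) blast
qed

section \<open>Expansions of functions on a disc\<close>

text \<open>Equality is required on the disc only: functions in \<open>A_alg R\<close> are total,
  and their values elsewhere are arbitrary.\<close>

definition expands :: "ereal \<Rightarrow> (real \<times> real \<Rightarrow> complex) \<Rightarrow> (nat \<Rightarrow> complex poly) \<Rightarrow> bool" where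
  "expands R f a \<longleftrightarrow> conv_coeffs R a \<and> (\<forall>p\<in>disc R. f p = hser a (to_complex p))"

lemma expands_coeffs: "expands R f a \<Longrightarrow> conv_coeffs R a"
  by (simp add: expands_def)

lemma expands_eq: "expands R f a \<Longrightarrow> p \<in> disc R \<Longrightarrow> f p = hser a (to_complex p)"
  by (simp add: expands_def)

lemma expands_hser: "conv_coeffs R a \<Longrightarrow> expands R (\<lambda>p. hser a (to_complex p)) a"
  by (simp add: expands_def)

lemma expands_add: "expands R f a \<Longrightarrow> expands R g b \<Longrightarrow> expands R (\<lambda>p. f p + g p) (\<lambda>m. a m + b m)"
  by (auto simp: expands_def mem_disc_iff hser_add conv_coeffs_add)

lemma expands_diff: "expands R f a \<Longrightarrow> expands R g b \<Longrightarrow> expands R (\<lambda>p. f p - g p) (\<lambda>m. a m - b m)"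
  by (auto simp: expands_def mem_disc_iff hser_diff conv_coeffs_diff)

lemma expands_has_derivative:
  assumes "expands R f a" "p \<in> disc R"
  shows "(f has_derivative (\<lambda>h. hser (dz a) (to_complex p) * to_complex h + hser (dzb a) (to_complex p) * cnj (to_complex h))) (at p)"
proof -
  have "((\<lambda>p. hser a (to_complex p)) has_derivative
      (\<lambda>h. hser (dz a) (to_complex p) * to_complex h + hser (dzb a) (to_complex p) * cnj (to_complex h))) (at p)"
    by (rule has_derivative_compose[OF bounded_linear_imp_has_derivative[OF bounded_linear_to_complex]
        hser_has_derivative[OF expands_coeffs[OF assms(1)]]])
      (use assms(2) in \<open>simp add: mem_disc_iff\<close>)
  then show ?thesis
    by (rule has_derivative_transform_within_open[OF _ open_disc assms(2)])
      (use assms(1) in \<open>simp add: expands_def\<close>)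
qed

definition dx :: "(nat \<Rightarrow> complex poly) \<Rightarrow> nat \<Rightarrow> complex poly" where
  "dx a m = dz a m + dzb a m"

definition dy :: "(nat \<Rightarrow> complex poly) \<Rightarrow> nat \<Rightarrow> complex poly" where
  "dy a m = smult \<i> (dz a m - dzb a m)"

lemma expands_pdx:
  assumes "expands R f a" shows "expands R (pdx f) (dx a)"
  unfolding expands_def
proof (intro conjI ballI)
  note cc = conv_coeffs_dz[OF expands_coeffs[OF assms]] conv_coeffs_dzb[OF expands_coeffs[OF assms]]
  show "conv_coeffs R (dx a)" unfolding dx_def[abs_def] by (intro conv_coeffs_add cc)
  fix p assume p: "p \<in> disc R"
  obtain x y where xy: "p = (x, y)" by (cases p)
  have "((\<lambda>s. (s, y)) has_derivative (\<lambda>h. (h, 0))) (at x)"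
    by (auto intro!: derivative_eq_intros)
  from has_derivative_compose[OF this expands_has_derivative[OF assms p[unfolded xy]]]
  have "((\<lambda>s. f (s, y)) has_vector_derivative (hser (dz a) (to_complex p) + hser (dzb a) (to_complex p))) (at x)"
    by (simp add: has_vector_derivative_def xy to_complex_Pair scaleR_conv_of_real algebra_simps)
  then show "pdx f p = hser (dx a) (to_complex p)"
    using p by (simp add: pdx_def xy vector_derivative_at dx_def[abs_def] hser_add[OF cc] mem_disc_iff)
qed

lemma expands_pdy:
  assumes "expands R f a" shows "expands R (pdy f) (dy a)"
  unfolding expands_def
proof (intro conjI ballI)
  note cc = conv_coeffs_dz[OF expands_coeffs[OF assms]] conv_coeffs_dzb[OF expands_coeffs[OF assms]]
  show "conv_coeffs R (dy a)" unfolding dy_def[abs_def] by (intro conv_coeffs_smult conv_coeffs_diff cc)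
  fix p assume p: "p \<in> disc R"
  obtain x y where xy: "p = (x, y)" by (cases p)
  have "((\<lambda>s. (x, s)) has_derivative (\<lambda>h. (0, h))) (at y)"
    by (auto intro!: derivative_eq_intros)
  from has_derivative_compose[OF this expands_has_derivative[OF assms p[unfolded xy]]]
  have "((\<lambda>s. f (x, s)) has_vector_derivative \<i> * (hser (dz a) (to_complex p) - hser (dzb a) (to_complex p))) (at y)"
    by (simp add: has_vector_derivative_def xy to_complex_Pair scaleR_conv_of_real algebra_simps)
  then show "pdy f p = hser (dy a) (to_complex p)"
    using p by (simp add: pdy_def xy vector_derivative_at dy_def[abs_def] mem_disc_iff
        hser_smult[OF conv_coeffs_diff[OF cc]] hser_diff[OF cc])
qed

lemma expands_imp_smooth_on:
  assumes "expands R f a" shows "smooth_on (disc R) f"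
  unfolding smooth_on_def
proof
  fix ws
  have "\<exists>b. expands R (pdw ws f) b"
    by (induction ws) (use assms in \<open>auto intro: expands_pdx expands_pdy\<close>)
  then show "pdw ws f differentiable_on disc R"
    by (auto simp: differentiable_on_def intro: differentiable_at_withinI differentiableI expands_has_derivative)
qed

section \<open>Taylor coefficients of an expansion\<close>

lemma dz_dzb_commute: "dz (dzb a) = dzb (dz a)"
proof (intro ext poly_eqI)
  fix m n show "coeff (dz (dzb a) m) n = coeff (dzb (dz a) m) n"
    by (simp add: dz_def dzb_def coeff_pderiv coeff_dbar algebra_simps)
qed

lemma dbar_add: "dbar m (p + q) = dbar m p + dbar m q"
  by (simp add: poly_eq_iff coeff_dbar algebra_simps)

lemma dbar_diff: "dbar m (p - q) = dbar m p - dbar m q"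
  by (simp add: poly_eq_iff coeff_dbar algebra_simps)

lemma dbar_smult: "dbar m (smult c p) = smult c (dbar m p)"
  by (simp add: poly_eq_iff coeff_dbar algebra_simps)

lemma dz_linear:
  "dz (\<lambda>m. a m + b m) = (\<lambda>m. dz a m + dz b m)" "dz (\<lambda>m. a m - b m) = (\<lambda>m. dz a m - dz b m)"
  "dz (\<lambda>m. smult c (a m)) = (\<lambda>m. smult c (dz a m))"
  by (simp_all add: dz_def fun_eq_iff pderiv_add pderiv_diff pderiv_smult)

lemma dzb_linear:
  "dzb (\<lambda>m. a m + b m) = (\<lambda>m. dzb a m + dzb b m)" "dzb (\<lambda>m. a m - b m) = (\<lambda>m. dzb a m - dzb b m)"
  "dzb (\<lambda>m. smult c (a m)) = (\<lambda>m. smult c (dzb a m))"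
  by (simp_all add: dzb_def fun_eq_iff dbar_add dbar_diff dbar_smult)

lemma dx_dy_commute: "dx (dy a) = dy (dx a)"
  unfolding dx_def[abs_def] dy_def[abs_def] dz_linear dzb_linear dz_dzb_commute
  by (simp add: fun_eq_iff smult_add_right smult_diff_right)

lemma dy_funpow_dx: "(dy ^^ k) (dx a) = dx ((dy ^^ k) a)"
  by (induction k) (simp_all add: dx_dy_commute)

text \<open>The factor \<open>Suc m\<close> is split as \<open>j + (Suc m - j)\<close>; each summand
  cancels into one of the two factorials, and the boundary terms vanish.\<close>

lemma sum_Leibniz_shift:
  fixes T :: "nat \<Rightarrow> nat \<Rightarrow> complex"
  shows "of_nat (Suc m) * (\<Sum>j\<le>Suc m. T j (Suc m - j) / (fact j * fact (Suc m - j)))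
    = (\<Sum>j\<le>m. T (Suc j) (m - j) / (fact j * fact (m - j)))
      + (\<Sum>j\<le>m. T j (Suc (m - j)) / (fact j * fact (m - j)))"
proof -
  have "of_nat (Suc m) * (\<Sum>j\<le>Suc m. T j (Suc m - j) / (fact j * fact (Suc m - j)))
     = (\<Sum>j\<le>Suc m. of_nat j * (T j (Suc m - j) / (fact j * fact (Suc m - j))))
     + (\<Sum>j\<le>Suc m. of_nat (Suc m - j) * (T j (Suc m - j) / (fact j * fact (Suc m - j))))"
    unfolding sum_distrib_left sum.distrib[symmetric] distrib_right[symmetric] of_nat_add[symmetric]
    by (intro sum.cong) auto
  also have "(\<Sum>j\<le>Suc m. of_nat j * (T j (Suc m - j) / (fact j * fact (Suc m - j))))
      = (\<Sum>j\<le>m. T (Suc j) (m - j) / (fact j * fact (m - j)))"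
    unfolding sum.atMost_Suc_shift[of _ m]
    by (simp del: of_nat_Suc add: field_simps)
  also have "(\<Sum>j\<le>Suc m. of_nat (Suc m - j) * (T j (Suc m - j) / (fact j * fact (Suc m - j))))
      = (\<Sum>j\<le>m. T j (Suc (m - j)) / (fact j * fact (m - j)))"
    unfolding sum.atMost_Suc[of _ m]
    by (simp del: of_nat_diff, intro sum.cong refl)
      (auto simp: Suc_diff_le field_simps simp del: of_nat_Suc of_nat_diff)
  finally show ?thesis .
qed

text \<open>Induction on the degree with \<open>a\<close> arbitrary: by Euler's identity,
  \<open>Suc m\<close> times the part of degree \<open>Suc m\<close> is \<open>x\<close> times the
  degree \<open>m\<close> part of \<open>dx a\<close> plus \<open>y\<close> times that of
  \<open>dy a\<close>.\<close>

lemma taylor_coeff_sum: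
  "(\<Sum>j\<le>m. coeff ((dx ^^ j) ((dy ^^ (m - j)) a) 0) 0 * of_real (x ^ j) * of_real (y ^ (m - j))
      / (fact j * fact (m - j))) = hpoly m (a m) (to_complex (x, y))"
proof (induction m arbitrary: a)
  case 0
  show ?case by (simp add: hpoly_def)
next
  case (Suc m)
  let ?z = "to_complex (x, y)"
  define T where "T = (\<lambda>j k. coeff ((dx ^^ j) ((dy ^^ k) a) 0) 0 * of_real (x ^ j) * of_real (y ^ k))"
  have 1: "T (Suc j) k / (fact j * fact k) = of_real x * (coeff ((dx ^^ j) ((dy ^^ k) (dx a)) 0) 0
      * of_real (x ^ j) * of_real (y ^ k) / (fact j * fact k))" for j k
    by (simp add: T_def dy_funpow_dx funpow_Suc_right del: funpow.simps(2))
  have 2: "T j (Suc k) / (fact j * fact k) = of_real y * (coeff ((dx ^^ j) ((dy ^^ k) (dy a)) 0) 0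
      * of_real (x ^ j) * of_real (y ^ k) / (fact j * fact k))" for j k
    by (simp add: T_def funpow_Suc_right del: funpow.simps(2))
  have "of_nat (Suc m) * (\<Sum>j\<le>Suc m. T j (Suc m - j) / (fact j * fact (Suc m - j)))
      = of_real x * hpoly m (dx a m) ?z + of_real y * hpoly m (dy a m) ?z"
    unfolding sum_Leibniz_shift 1 2 sum_distrib_left[symmetric] Suc.IH ..
  also have "\<dots> = ?z * hpoly m (dz a m) ?z + cnj ?z * hpoly m (dzb a m) ?z"
    by (simp add: dx_def dy_def hpoly_add hpoly_diff hpoly_smult to_complex_Pair algebra_simps)
  also have "\<dots> = of_nat (Suc m) * hpoly (Suc m) (a (Suc m)) ?z"
    unfolding dz_def dzb_def by (rule hpoly_Euler)
  finally show ?case unfolding T_def by (simp del: of_nat_Suc)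
qed

text \<open>All mixed partial derivatives expand too, and at the origin an expansion reduces to its
  constant coefficient. Positivity of \<open>R\<close> puts the origin in the disc.\<close>

lemma taylor_hom_expands:
  assumes "expands R f a" "0 < R"
  shows "taylor_hom f m p = hpoly m (a m) (to_complex p)"
proof -
  obtain x y where xy: "p = (x, y)" by (cases p)
  have y: "expands R ((pdy ^^ k) f) ((dy ^^ k) a)" for k
    by (induction k) (use assms in \<open>auto intro: expands_pdy\<close>)
  have x: "expands R ((pdx ^^ j) ((pdy ^^ k) f)) ((dx ^^ j) ((dy ^^ k) a))" for j k
    by (induction j) (auto intro: expands_pdx y)
  have "(pdx ^^ j) ((pdy ^^ k) f) (0, 0) = coeff ((dx ^^ j) ((dy ^^ k) a) 0) 0" for j k
    using expands_eq[OF x, of "(0, 0)"] assms(2) by (simp add: mem_disc_iff hser_0 zero_ereal_def)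
  then show ?thesis
    unfolding taylor_hom_def xy taylor_coeff_sum[symmetric] by simp
qed

text \<open>The forms of an expansion are the homogeneous Taylor parts, so the function determines
  them. This lets identities between functions be read degree by degree.\<close>

lemma expands_unique:
  assumes "expands R f a" "expands R g b" "0 < R" "\<And>p. p \<in> disc R \<Longrightarrow> f p = g p"
  shows "a m = b m"
proof (rule hpoly_cancel)
  have f: "expands R f b" using assms(2,4) by (simp add: expands_def)
  fix z obtain p where "z = to_complex p" using surj_to_complex by metis
  then show "hpoly m (a m) z = hpoly m (b m) z"
    using taylor_hom_expands[OF assms(1,3), of m p] taylor_hom_expands[OF f assms(3), of m p] by simp
qed (use assms in \<open>auto simp: expands_def conv_coeffs_def\<close>)

text \<open>The continuous norm attains its maximum on \<open>K\<close>; the empty set has no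
  maximiser, so any positive radius below \<open>R\<close> serves there.\<close>

lemma compact_subset_disc:
  assumes "compact K" "K \<subseteq> disc R" "0 < R"
  obtains \<rho> where "0 < \<rho>" "ereal \<rho> < R" "\<And>p. p \<in> K \<Longrightarrow> norm (to_complex p) \<le> \<rho>"
proof (cases "K = {}")
  case True
  then show ?thesis using ereal_between_pos[of 0 R] assms(3) that by (auto simp: zero_ereal_def)
next
  case False
  obtain q where q: "q \<in> K" "\<And>p. p \<in> K \<Longrightarrow> norm (to_complex p) \<le> norm (to_complex q)"
    using continuous_attains_sup[OF assms(1) False continuous_on_norm[OF continuous_on_to_complex]] by blast
  then have "ereal (norm (to_complex q)) < R" using assms(2) by (auto simp: mem_disc_iff)
  then obtain \<rho> where "norm (to_complex q) < \<rho>" "0 < \<rho>" "ereal \<rho> < R" by (auto elim: ereal_between_pos)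
  then show ?thesis using that q(2) by (metis less_imp_le order_trans)
qed

text \<open>On a compact set within radius \<open>\<rho>\<close> below \<open>R\<close> the terms
  \<open>pnorm (a m) * \<rho> ^ m\<close> are majorants, and the Weierstrass test gives uniform and
  absolute convergence.\<close>

lemma expands_imp_A_alg:
  assumes "expands R f a" "0 < R"
  shows "f \<in> A_alg R"
  unfolding A_alg_def
proof (intro CollectI conjI allI impI; (elim conjE)?)
  show "smooth_on (disc R) f" by (rule expands_imp_smooth_on[OF assms(1)])
  fix K assume K: "compact K" "K \<subseteq> disc R"
  obtain \<rho> where \<rho>: "0 < \<rho>" "ereal \<rho> < R" "\<And>p. p \<in> K \<Longrightarrow> norm (to_complex p) \<le> \<rho>"
    using compact_subset_disc[OF K assms(2)] by blast
  note cc = expands_coeffs[OF assms(1)]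
  have bd: "norm (hpoly m (a m) (to_complex p)) \<le> pnorm (a m) * \<rho> ^ m" if "p \<in> K" for m p
    by (rule norm_hpoly_le'[OF conv_coeffs_degree[OF cc] \<rho>(3)[OF that]])
  note sm = summable_belowD[OF conv_coeffs_summable_below[OF cc] \<rho>(1,2)]
  have "uniform_limit K (\<lambda>n p. \<Sum>m<n. hpoly m (a m) (to_complex p)) (\<lambda>p. hser a (to_complex p)) sequentially"
    unfolding hser_def by (rule Weierstrass_m_test[OF bd sm])
  then show "uniform_limit K (\<lambda>n p. \<Sum>m<n. taylor_hom f m p) f sequentially"
    unfolding taylor_hom_expands[OF assms]
    by (rule uniform_limit_cong'[THEN iffD1, rotated 2]) (use K assms(1) in \<open>auto simp: expands_def\<close>)
  show "uniformly_convergent_on K (\<lambda>n p. \<Sum>m<n. norm (taylor_hom f m p))"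
    unfolding taylor_hom_expands[OF assms]
    by (rule Weierstrass_m_test'[OF _ sm]) (use bd in auto)
qed

section \<open>Taylor parts in the coordinates \<open>z\<close> and \<open>cnj z\<close>\<close>

definition Xp :: "complex poly" where "Xp = [:1/2, 1/2:]"
text \<open>In \<open>Xp\<close> and \<open>Yp\<close> the constant coefficient belongs to
  \<open>cnj z\<close> and the linear one to \<open>z\<close>, so these are
  \<open>(z + cnj z) / 2\<close> and \<open>(z - cnj z) / (2 * \<i>)\<close>.\<close>

definition Yp :: "complex poly" where "Yp = [:\<i>/2, -\<i>/2:]"

lemma hpoly_1_Xp: "hpoly 1 Xp (to_complex (x, y)) = of_real x"
  by (simp add: hpoly_def Xp_def to_complex_Pair field_simps)

lemma hpoly_1_Yp: "hpoly 1 Yp (to_complex (x, y)) = of_real y"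
  by (simp add: hpoly_def Yp_def to_complex_Pair field_simps)

lemma degree_Xp: "degree Xp \<le> 1" and degree_Yp: "degree Yp \<le> 1"
  by (simp_all add: Xp_def Yp_def)

lemma degree_power_le1: "degree p \<le> 1 \<Longrightarrow> degree (p ^ n) \<le> n"
  using degree_power_le[of p n] by (metis mult.left_neutral mult_le_mono1 order_trans)

lemma hpoly_power: "degree p \<le> 1 \<Longrightarrow> hpoly n (p ^ n) z = hpoly 1 p z ^ n"
proof (induction n)
  case (Suc n)
  then show ?case using hpoly_mult[of p 1 "p ^ n" n z] degree_power_le1[of p n] by simp
qed (simp add: hpoly_def)

text \<open>Pure algebra: substituting \<open>Xp\<close> and \<open>Yp\<close> for the coordinates
  turns each Taylor part into a form in \<open>z\<close> and \<open>cnj z\<close>.\<close>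

lemma taylor_hom_eq_hpoly:
  fixes f :: "real \<times> real \<Rightarrow> complex"
  obtains a where "\<And>m. degree (a m) \<le> m" "\<And>m p. taylor_hom f m p = hpoly m (a m) (to_complex p)"
proof
  define a where "a m = (\<Sum>j\<le>m. smult ((pdx ^^ j) ((pdy ^^ (m - j)) f) (0, 0) / of_nat (fact j * fact (m - j)))
      (Xp ^ j * Yp ^ (m - j)))" for m
  have d: "degree (Xp ^ j * Yp ^ (m - j)) \<le> m" if "j \<le> m" for j m
    using degree_mult_le[of "Xp ^ j" "Yp ^ (m - j)"] degree_power_le1[OF degree_Xp, of j]
      degree_power_le1[OF degree_Yp, of "m - j"] that by linarith
  show "degree (a m) \<le> m" for m
    unfolding a_def by (intro degree_sum_le order_trans[OF degree_smult_le] d) auto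
  fix m and p :: "real \<times> real"
  obtain x y where xy: "p = (x, y)" by (cases p)
  have "hpoly m (Xp ^ j * Yp ^ (m - j)) (to_complex (x, y)) = of_real (x ^ j) * of_real (y ^ (m - j))"
    if "j \<le> m" for j
    using hpoly_mult[OF degree_power_le1[OF degree_Xp, of j] degree_power_le1[OF degree_Yp, of "m - j"]]
      that
    by (simp add: hpoly_power[OF degree_Xp] hpoly_power[OF degree_Yp] hpoly_1_Xp hpoly_1_Yp del: One_nat_def)
  then show "taylor_hom f m p = hpoly m (a m) (to_complex p)"
    by (simp add: taylor_hom_def xy a_def hpoly_sum hpoly_smult mult.assoc)
qed

text \<open>Uniform convergence on a circle forces the single forms to be eventually bounded by 1
  there. Cauchy's estimate bounds each coefficient, hence \<open>pnorm (a m) * \<rho> ^ m\<close> by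
  \<open>m + 1\<close>, and Abel's lemma gives summability.\<close>

lemma A_alg_imp_expands:
  assumes "f \<in> A_alg R"
  obtains a where "expands R f a"
proof -
  obtain a where a: "\<And>m. degree (a m) \<le> m" "\<And>m p. taylor_hom f m p = hpoly m (a m) (to_complex p)"
    using taylor_hom_eq_hpoly[of f] by blast
  have U: "uniform_limit K (\<lambda>n p. \<Sum>m<n. hpoly m (a m) (to_complex p)) f sequentially"
    if "compact K" "K \<subseteq> disc R" for K
  proof -
    have "uniform_limit K (\<lambda>n p. \<Sum>m<n. taylor_hom f m p) f sequentially"
      using assms that by (simp add: A_alg_def)
    then show ?thesis by (simp only: a(2))
  qed
  have "summable_below R (\<lambda>m. pnorm (a m))"
  proof (rule summable_below_of_bounded_terms)
    fix \<rho> :: real assume \<rho>: "0 < \<rho>" "ereal \<rho> < R"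
    define K where "K = (\<lambda>z. (Re z, Im z)) ` sphere 0 \<rho>"
    have "compact K" unfolding K_def by (intro compact_continuous_image continuous_intros) auto
    moreover have "K \<subseteq> disc R" using \<rho> by (auto simp: K_def mem_disc_iff to_complex_def)
    ultimately have "uniform_limit K (\<lambda>n p. \<Sum>m<n. hpoly m (a m) (to_complex p)) f sequentially" by (rule U)
    from uniform_limitD[OF this, of "1 / 2"] obtain M where
      M: "\<And>n p. n \<ge> M \<Longrightarrow> p \<in> K \<Longrightarrow> dist (\<Sum>m<n. hpoly m (a m) (to_complex p)) (f p) < 1 / 2"
      by (auto simp: eventually_sequentially)
    have "norm (pnorm (a m) * \<rho> ^ m) \<le> real (m + 1)" if m: "m \<ge> M" for m
    proof -
      have "norm (coeff (a m) j) * \<rho> ^ m \<le> 1" for j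
      proof (rule norm_coeff_le_sup_hpoly[OF a(1) \<rho>(1)])
        fix z :: complex assume "norm z = \<rho>"
        then obtain p where p: "p \<in> K" "to_complex p = z" by (force simp: K_def to_complex_def)
        \<comment> \<open>A form is the difference of two consecutive partial sums, each within
          \<open>1 / 2\<close> of \<open>f\<close> on the circle.\<close>
        have "hpoly m (a m) z = (\<Sum>m<Suc m. hpoly m (a m) (to_complex p)) - (\<Sum>m<m. hpoly m (a m) (to_complex p))"
          by (simp add: p)
        then show "norm (hpoly m (a m) z) \<le> 1"
          using dist_triangle_half_l[OF M[OF le_SucI[OF m] p(1)] M[OF m p(1)]]
          unfolding dist_norm by simp
      qed
      then have "(\<Sum>j\<le>m. norm (coeff (a m) j) * \<rho> ^ m) \<le> (\<Sum>j\<le>m. 1)" by (intro sum_mono)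
      then show ?thesis using \<rho>(1)
        by (simp add: pnorm_eq_sum[OF a(1)] abs_mult sum_distrib_right sum_nonneg)
    qed
    then show "\<exists>M. \<forall>m\<ge>M. norm (pnorm (a m) * \<rho> ^ m) \<le> real (m + 1)" by blast
  qed
  then have cc: "conv_coeffs R a" using a(1) by (simp add: conv_coeffs_def)
  have "f p = hser a (to_complex p)" if "p \<in> disc R" for p
  proof (rule LIMSEQ_unique)
    show "(\<lambda>n. \<Sum>m<n. hpoly m (a m) (to_complex p)) \<longlonglongrightarrow> f p"
      using tendsto_uniform_limitI[OF U[of "{p}"]] that by auto
    show "(\<lambda>n. \<Sum>m<n. hpoly m (a m) (to_complex p)) \<longlonglongrightarrow> hser a (to_complex p)"
      using hser_sums[OF cc] that by (simp add: mem_disc_iff sums_def)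
  qed
  then show ?thesis using cc that[of a] unfolding expands_def by blast
qed

section \<open>Products and the bilaplacian on coefficients\<close>

definition cauchy_prod :: "(nat \<Rightarrow> complex poly) \<Rightarrow> (nat \<Rightarrow> complex poly) \<Rightarrow> nat \<Rightarrow> complex poly" where
  "cauchy_prod a b m = (\<Sum>i\<le>m. a i * b (m - i))"

lemma degree_cauchy_prod:
  assumes "\<And>m. degree (a m) \<le> m" "\<And>m. degree (b m) \<le> m"
  shows "degree (cauchy_prod a b m) \<le> m"
  unfolding cauchy_prod_def
proof (intro degree_sum_le)
  fix i assume "i \<in> {..m}"
  then show "degree (a i * b (m - i)) \<le> m"
    using degree_mult_le[of "a i" "b (m - i)"] assms(1)[of i] assms(2)[of "m - i"] by simp
qed simp

lemma pnorm_cauchy_prod: "pnorm (cauchy_prod a b m) \<le> (\<Sum>i\<le>m. pnorm (a i) * pnorm (b (m - i)))"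
  unfolding cauchy_prod_def by (rule order_trans[OF pnorm_sum sum_mono[OF pnorm_mult]])

lemma conv_coeffs_cauchy_prod:
  assumes "conv_coeffs R a" "conv_coeffs R b"
  shows "conv_coeffs R (cauchy_prod a b)"
  unfolding conv_coeffs_def
proof
  show "\<forall>m. degree (cauchy_prod a b m) \<le> m"
    using assms by (auto intro: degree_cauchy_prod conv_coeffs_degree)
  have "summable_below R (\<lambda>m. \<Sum>i\<le>m. pnorm (a i) * pnorm (b (m - i)))"
    unfolding summable_below_def
  proof (intro allI impI)
    fix \<rho> :: real assume \<rho>: "0 < \<rho>" "ereal \<rho> < R"
    have "summable (\<lambda>m. norm (pnorm (c m) * \<rho> ^ m))" if "conv_coeffs R c" for c
      using summable_belowD[OF conv_coeffs_summable_below[OF that] \<rho>] \<rho>(1) by (simp add: abs_mult)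
    from summable_Cauchy_product[OF this[OF assms(1)] this[OF assms(2)]]
    show "summable (\<lambda>m. (\<Sum>i\<le>m. pnorm (a i) * pnorm (b (m - i))) * \<rho> ^ m)"
      by (rule summable_cong[THEN iffD1, rotated])
        (auto simp: sum_distrib_left algebra_simps simp flip: power_add intro!: always_eventually sum.cong)
  qed
  then show "summable_below R (\<lambda>m. pnorm (cauchy_prod a b m))"
    by (rule summable_below_mono) (auto intro: pnorm_cauchy_prod)
qed

lemma expands_mult:
  assumes "expands R f a" "expands R g b"
  shows "expands R (\<lambda>p. f p * g p) (cauchy_prod a b)"
  unfolding expands_def
proof (intro conjI ballI)
  note a = expands_coeffs[OF assms(1)] and b = expands_coeffs[OF assms(2)]
  show "conv_coeffs R (cauchy_prod a b)" by (rule conv_coeffs_cauchy_prod[OF a b])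
  fix p assume p: "p \<in> disc R"
  then have z: "ereal (norm (to_complex p)) < R" by (simp add: mem_disc_iff)
  have "hpoly m (cauchy_prod a b m) (to_complex p) = (\<Sum>i\<le>m. hpoly i (a i) (to_complex p) * hpoly (m - i) (b (m - i)) (to_complex p))" for m
    unfolding cauchy_prod_def hpoly_sum
  proof (intro sum.cong refl)
    fix i assume "i \<in> {..m}"
    then show "hpoly m (a i * b (m - i)) (to_complex p) = hpoly i (a i) (to_complex p) * hpoly (m - i) (b (m - i)) (to_complex p)"
      using hpoly_mult[OF conv_coeffs_degree[OF a, of i] conv_coeffs_degree[OF b, of "m - i"]] by simp
  qed
  then show "f p * g p = hser (cauchy_prod a b) (to_complex p)"
    using Cauchy_product[OF summable_norm_hpoly[OF a z] summable_norm_hpoly[OF b z]]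
    by (simp add: expands_eq[OF assms(1) p] expands_eq[OF assms(2) p] hser_def)
qed

text \<open>The Laplacian is 4 times the mixed Wirtinger derivative, so its square carries the
  factor 16; degree \<open>m\<close> comes from degree \<open>m + 4\<close>.\<close>

definition bilap :: "(nat \<Rightarrow> complex poly) \<Rightarrow> nat \<Rightarrow> complex poly" where
  "bilap a m = smult 16 (dz (dz (dzb (dzb a))) m)"

lemma expands_laplacian:
  assumes "expands R f a"
  shows "expands R (laplacian f) (\<lambda>m. smult 4 (dz (dzb a) m))"
proof -
  have "expands R (laplacian f) (\<lambda>m. dx (dx a) m + dy (dy a) m)"
    unfolding laplacian_def by (intro expands_add expands_pdx expands_pdy assms)
  also have "(\<lambda>m. dx (dx a) m + dy (dy a) m) = (\<lambda>m. smult 4 (dz (dzb a) m))"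
    unfolding dx_def[abs_def] dy_def[abs_def] dz_linear dzb_linear dz_dzb_commute
    by (intro ext poly_eqI) (simp only: coeff_add coeff_diff coeff_smult, simp add: algebra_simps)
  finally show ?thesis .
qed

lemma expands_bilaplacian:
  assumes "expands R f a"
  shows "expands R (laplacian (laplacian f)) (bilap a)"
  using expands_laplacian[OF expands_laplacian[OF assms]]
  by (simp add: bilap_def[abs_def] dz_linear dzb_linear dz_dzb_commute)

section \<open>The homogeneous Goursat problem\<close>

text \<open>The arguments \<open>m + 4\<close> and \<open>m + 3\<close> are the degrees of the forms
  to which \<open>dbar\<close> is applied.\<close>

definition bilap_hom :: "nat \<Rightarrow> complex poly \<Rightarrow> complex poly" where
  "bilap_hom m u = smult 16 (pderiv (pderiv (dbar (m + 3) (dbar (m + 4) u))))"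

lemma bilap_eq_bilap_hom: "bilap a m = bilap_hom m (a (m + 4))"
  by (simp add: bilap_def dz_def dzb_def bilap_hom_def numeral_eq_Suc)

text \<open>The operator is diagonal up to a shift by 2. The differences are complex, so the factor
  is 0 at \<open>j = m + 1\<close> and \<open>j = m + 2\<close>; with the exponents 0 and 1, which
  are never reached, this gives the four-dimensional kernel.\<close>

lemma coeff_bilap_hom:
  "coeff (bilap_hom m u) j = 16 * of_nat ((j + 1) * (j + 2)) * ((of_nat m + 1 - of_nat j) * (of_nat m + 2 - of_nat j))
     * coeff u (j + 2)"
  by (simp add: bilap_hom_def coeff_pderiv coeff_dbar numeral_eq_Suc algebra_simps)

lemma bilap_hom_add: "bilap_hom m (u + v) = bilap_hom m u + bilap_hom m v"
  by (simp add: poly_eq_iff coeff_bilap_hom algebra_simps)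

lemma bilap_hom_diff: "bilap_hom m (u - v) = bilap_hom m u - bilap_hom m v"
  by (simp add: poly_eq_iff coeff_bilap_hom algebra_simps)

text \<open>The four parameters multiply the biharmonic forms \<open>z ^ (m + 4)\<close>,
  \<open>z ^ (m + 3) * cnj z\<close>, \<open>z * cnj z ^ (m + 3)\<close> and
  \<open>cnj z ^ (m + 4)\<close>.\<close>

definition biharm :: "nat \<Rightarrow> complex \<Rightarrow> complex \<Rightarrow> complex \<Rightarrow> complex \<Rightarrow> complex poly" where
  "biharm m A B C D = monom A (m + 4) + monom B (m + 3) + [:D, C:]"

lemma degree_biharm: "degree (biharm m A B C D) \<le> m + 4"
  unfolding biharm_def
  by (intro degree_add_le order_trans[OF degree_monom_le]) auto

lemma bilap_hom_biharm: "bilap_hom m (biharm m A B C D) = 0"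
proof (rule poly_eqI)
  fix j
  show "coeff (bilap_hom m (biharm m A B C D)) j = coeff 0 j"
    by (cases "j = m + 1 \<or> j = m + 2") (auto simp: coeff_bilap_hom biharm_def coeff_pCons split: nat.splits)
qed

lemma eq_biharm_if_bilap_hom_eq_0:
  assumes "degree u \<le> m + 4" "bilap_hom m u = 0"
  shows "u = biharm m (coeff u (m + 4)) (coeff u (m + 3)) (coeff u 1) (coeff u 0)"
proof (rule poly_eqI)
  fix k
  have z: "coeff u (j + 2) = 0" if "j \<le> m" for j
  proof -
    have "coeff (bilap_hom m u) j = 0" using assms(2) by simp
    moreover have "of_nat m + 1 - of_nat j = (of_nat (m + 1 - j) :: complex)"
      "of_nat m + 2 - of_nat j = (of_nat (m + 2 - j) :: complex)"
      using that by (simp_all add: of_nat_diff)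
    ultimately show ?thesis using that unfolding coeff_bilap_hom by (auto simp del: of_nat_diff of_nat_Suc of_nat_add)
  qed
  consider "k = 0" | "k = 1" | "2 \<le> k" "k \<le> m + 2" | "k = m + 3" | "k = m + 4" | "k > m + 4" by linarith
  then show "coeff u k = coeff (biharm m (coeff u (m + 4)) (coeff u (m + 3)) (coeff u 1) (coeff u 0)) k"
  proof cases
    case 3
    then show ?thesis using z[of "k - 2"]
      by (auto simp: biharm_def coeff_pCons split: nat.splits)
  next
    case 6
    then show ?thesis using assms(1) by (auto simp: biharm_def coeff_pCons coeff_eq_0 split: nat.splits)
  qed (auto simp: biharm_def coeff_pCons split: nat.splits)
qed

text \<open>Divide the coefficients by the diagonal entries, which are at least
  \<open>(m + 1)\<^sup>2\<close>; this is where two powers of the degree are gained.\<close>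

lemma bilap_hom_right_inverse:
  assumes "degree h \<le> m"
  obtains v where "degree v \<le> m + 4" "bilap_hom m v = h" "pnorm v \<le> pnorm h / (real (m + 1))\<^sup>2"
proof -
  \<comment> \<open>The diagonal entry of \<open>coeff_bilap_hom\<close> in natural numbers, grouped
    so that each of the two inner products is at least \<open>m + 1\<close>.\<close>
  define l where "l j = 16 * (((j + 1) * (m + 1 - j)) * ((j + 2) * (m + 2 - j)))" for j
  have l: "(m + 1)\<^sup>2 \<le> l j" if jm: "j \<le> m" for j
  proof -
    obtain i where i: "m = j + i" using le_Suc_ex[OF jm] by blast
    have e: "m + 1 - j = i + 1" "m + 2 - j = i + 2" by (simp_all add: i)
    have "m + 1 \<le> (j + 1) * (m + 1 - j)" "m + 1 \<le> (j + 2) * (m + 2 - j)" unfolding e by (simp_all add: i)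
    then have "(m + 1) * (m + 1) \<le> ((j + 1) * (m + 1 - j)) * ((j + 2) * (m + 2 - j))" by (rule mult_le_mono)
    also have "\<dots> \<le> l j" unfolding l_def by linarith
    finally show ?thesis by (simp only: power2_eq_square)
  qed
  define v where "v = (\<Sum>j\<le>m. monom (coeff h j / of_nat (l j)) (j + 2))"
  have cv: "coeff v (j + 2) = (if j \<le> m then coeff h j / of_nat (l j) else 0)" for j
    by (simp add: v_def coeff_sum)
  show thesis
  proof
    show "degree v \<le> m + 4"
      unfolding v_def by (intro degree_sum_le order_trans[OF degree_monom_le]) auto
    show "bilap_hom m v = h"
    proof (rule poly_eqI)
      fix j
      show "coeff (bilap_hom m v) j = coeff h j"
      proof (cases "j \<le> m")
        case True
        have "of_nat m + 1 - of_nat j = (of_nat (m + 1 - j) :: complex)"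
          "of_nat m + 2 - of_nat j = (of_nat (m + 2 - j) :: complex)"
          using True by (simp_all add: of_nat_diff)
        then have "coeff (bilap_hom m v) j = of_nat (l j) * coeff v (j + 2)"
          unfolding coeff_bilap_hom l_def by (simp only: of_nat_mult of_nat_numeral mult_ac)
        moreover have "l j \<noteq> 0" using l[OF True] zero_less_power[of "m + 1" 2] by linarith
        ultimately show ?thesis using True unfolding cv by simp
      next
        case False
        then show ?thesis using assms unfolding coeff_bilap_hom cv by (simp add: coeff_eq_0)
      qed
    qed
    have "pnorm v \<le> (\<Sum>j\<le>m. norm (coeff h j) / real (l j))"
      unfolding v_def by (rule order_trans[OF pnorm_sum]) (simp add: norm_divide)
    also have "\<dots> \<le> (\<Sum>j\<le>m. norm (coeff h j) / (real (m + 1))\<^sup>2)"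
    proof (intro sum_mono divide_left_mono)
      fix j assume "j \<in> {..m}"
      then have "(m + 1)\<^sup>2 \<le> l j" by (intro l) auto
      then have "real ((m + 1)\<^sup>2) \<le> real (l j)" by (simp only: of_nat_le_iff)
      then show le: "(real (m + 1))\<^sup>2 \<le> real (l j)" by simp
      have "0 < (real (m + 1))\<^sup>2" by simp
      then show "0 < real (l j) * (real (m + 1))\<^sup>2"
        using le by (intro mult_pos_pos) linarith+
    qed auto
    finally show "pnorm v \<le> pnorm h / (real (m + 1))\<^sup>2"
      by (simp add: pnorm_eq_sum[OF assms] sum_divide_distrib)
  qed
qed

section \<open>Interpolation by biharmonic forms at the four roots\<close>

lemma sum_diff_eq_iff:
  fixes x y a b :: complex
  shows "x + y = a \<and> x - y = b \<longleftrightarrow> x = (a + b) / 2 \<and> y = (a - b) / 2"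
  by (auto simp: add_divide_distrib diff_divide_distrib)

lemma mult_eq_half_iff:
  fixes x k e :: complex
  shows "k \<noteq> 0 \<Longrightarrow> x * k = e / 2 \<longleftrightarrow> x = e / (2 * k)"
  by (auto simp: field_simps)

lemma mult_divide_eq_half_iff:
  fixes x k w e :: complex
  shows "k \<noteq> 0 \<Longrightarrow> w \<noteq> 0 \<Longrightarrow> x * k / w = e / 2 \<longleftrightarrow> x = e * w / (2 * k)"
  by (auto simp: field_simps)

lemma quotient_mult_eq_iff:
  fixes x k w n e :: complex
  shows "k \<noteq> 0 \<Longrightarrow> w \<noteq> 0 \<Longrightarrow> n \<noteq> 0 \<Longrightarrow> k / w * x * n = e \<longleftrightarrow> x = e * w / (k * n)"
  by (auto simp: field_simps)

text \<open>Abstracts from \<open>t\<close> and \<open>\<beta>\<close>: the interpolation needs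
  modulus 1 and a lower bound of order \<open>1 / n\<close> for the divisors, which in particular
  excludes roots of unity.\<close>

locale small_divisors =
  fixes \<omega> :: complex and \<delta> :: real
  assumes norm_\<omega>: "norm \<omega> = 1"
    and \<delta>_pos: "\<delta> > 0"
    and small_div: "\<And>n. n > 0 \<Longrightarrow> \<delta> / real n \<le> norm (\<omega> ^ n - 1)"
begin

lemma \<omega>_nz: "\<omega> \<noteq> 0"
  using norm_\<omega> by auto

lemma \<omega>_pow_neq: "n > 0 \<Longrightarrow> \<omega> ^ n \<noteq> 1"
  using small_div[of n] \<delta>_pos by (auto simp: field_simps)

lemma \<omega>_sq: "\<omega>\<^sup>2 \<noteq> 1" "1 + \<omega>\<^sup>2 \<noteq> 0"
proof -
  \<comment> \<open>Both factors are nonzero because \<open>\<omega>\<close> is not a fourth root of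
    unity.\<close>
  have "\<omega> ^ 4 - 1 = (\<omega>\<^sup>2 - 1) * (1 + \<omega>\<^sup>2)" by (simp add: algebra_simps power2_eq_square power4_eq_xxxx)
  then show "\<omega>\<^sup>2 \<noteq> 1" "1 + \<omega>\<^sup>2 \<noteq> 0" using \<omega>_pow_neq[of 4] by auto
qed

text \<open>The parity of \<open>m\<close> enters through the powers of \<open>-1\<close> and of
  \<open>- 1 / \<omega>\<close>.\<close>

lemma poly_biharm:
  fixes m A B C D
  defines "W \<equiv> \<omega> ^ (m + 4)" and "p \<equiv> biharm m A B C D"
  shows "poly p 1 = A + B + C + D"
    and "poly p (-1) = (if even m then A - B - C + D else - A + B - C + D)"
    and "poly p \<omega> = A * W + B * W / \<omega> + C * \<omega> + D"
    and "poly p (- 1 / \<omega>) = (if even m then A / W - B * \<omega> / W - C / \<omega> + D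
            else - A / W + B * \<omega> / W - C / \<omega> + D)"
proof -
  define y where "y = - 1 / \<omega>"
  have p: "poly p z = A * z ^ (m + 4) + B * z ^ (m + 3) + (D + C * z)" for z
    by (simp add: p_def biharm_def poly_monom mult.commute)
  have W3: "\<omega> ^ (m + 3) = W / \<omega>" using \<omega>_nz by (simp add: W_def numeral_eq_Suc)
  have y4: "y ^ (m + 4) = (if even m then 1 / W else - 1 / W)"
    by (simp add: y_def W_def power_divide)
  have "y ^ (m + 4) = y * y ^ (m + 3)" by (simp add: numeral_eq_Suc)
  then have y3: "y ^ (m + 3) = - \<omega> * y ^ (m + 4)" using \<omega>_nz by (simp add: y_def)
  show "poly p 1 = A + B + C + D"
    and "poly p (-1) = (if even m then A - B - C + D else - A + B - C + D)"
    by (simp_all add: p)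
  show "poly p \<omega> = A * W + B * W / \<omega> + C * \<omega> + D"
    unfolding p W3 by (simp add: W_def)
  have "poly p y = (if even m then A / W - B * \<omega> / W + C * y + D
            else - A / W + B * \<omega> / W + C * y + D)"
    unfolding p y3 y4 by simp
  then show "poly p (- 1 / \<omega>) = (if even m then A / W - B * \<omega> / W - C / \<omega> + D
            else - A / W + B * \<omega> / W - C / \<omega> + D)"
    by (simp add: y_def)
qed

text \<open>The values at \<open>\<plusminus>1\<close> determine the sums of the coefficients of equal parity (\<open>s\<close> and \<open>d\<close>);
  eliminating \<open>C\<close> and \<open>D\<close> decouples the remaining two equations up to the divisors below.\<close>

lemma biharm_even_iff:
  fixes A B C D b1 b2 b3 b4 W :: complex
  defines "s \<equiv> (b1 + b2) / 2" and "d \<equiv> (b1 - b2) / 2"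
  defines "e1 \<equiv> b3 - s - d * \<omega>" and "e2 \<equiv> b4 * W - s * W + d * W / \<omega>"
  assumes "W \<noteq> 0" "W \<noteq> 1" "W \<noteq> \<omega>\<^sup>2"
  shows "(A + B + C + D = b1 \<and> A - B - C + D = b2 \<and> A * W + B * W / \<omega> + C * \<omega> + D = b3
      \<and> A / W - B * \<omega> / W - C / \<omega> + D = b4) \<longleftrightarrow>
    (A = (e1 - e2) / (2 * (W - 1)) \<and> B = (e1 + e2) * \<omega> / (2 * (W - \<omega>\<^sup>2)) \<and> C = d - B \<and> D = s - A)"
proof -
  have "A + B + C + D = (A + D) + (B + C)" "A - B - C + D = (A + D) - (B + C)" by simp_all
  then have "A + B + C + D = b1 \<and> A - B - C + D = b2 \<longleftrightarrow> A + D = s \<and> B + C = d"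
    unfolding s_def d_def by (simp only: sum_diff_eq_iff)
  also have "\<dots> \<longleftrightarrow> C = d - B \<and> D = s - A" by (auto simp: algebra_simps)
  finally have "A + B + C + D = b1 \<and> A - B - C + D = b2 \<longleftrightarrow> C = d - B \<and> D = s - A" .
  moreover have "A * W + B * W / \<omega> + C * \<omega> + D = b3 \<and> A / W - B * \<omega> / W - C / \<omega> + D = b4
     \<longleftrightarrow> A = (e1 - e2) / (2 * (W - 1)) \<and> B = (e1 + e2) * \<omega> / (2 * (W - \<omega>\<^sup>2))"
    if CD: "C = d - B" "D = s - A"
  proof -
    have 3: "A * W + B * W / \<omega> + C * \<omega> + D = b3 \<longleftrightarrow> A * (W - 1) + B * (W - \<omega>\<^sup>2) / \<omega> = e1"
      using \<omega>_nz by (auto simp: CD e1_def field_simps power2_eq_square)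
    have "A / W - B * \<omega> / W - C / \<omega> + D = b4 \<longleftrightarrow> (A / W - B * \<omega> / W - C / \<omega> + D) * W = b4 * W"
      using assms by simp
    also have "(A / W - B * \<omega> / W - C / \<omega> + D) * W = - A * (W - 1) + B * (W - \<omega>\<^sup>2) / \<omega> + (s * W - d * W / \<omega>)"
      using \<omega>_nz assms by (simp add: CD field_simps power2_eq_square)
    also have "\<dots> = b4 * W \<longleftrightarrow> - A * (W - 1) + B * (W - \<omega>\<^sup>2) / \<omega> = e2"
      unfolding e2_def by (auto simp: algebra_simps)
    finally have 4: "A / W - B * \<omega> / W - C / \<omega> + D = b4 \<longleftrightarrow> - A * (W - 1) + B * (W - \<omega>\<^sup>2) / \<omega> = e2" .
    \<comment> \<open>In \<open>x = A * (W - 1)\<close> and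
      \<open>y = B * (W - \<omega>\<^sup>2) / \<omega>\<close> the system consists of a sum and a
      difference, so each unknown has its own divisor.\<close>
    have "x + y = e1 \<and> - x + y = e2 \<longleftrightarrow> x = (e1 - e2) / 2 \<and> y = (e1 + e2) / 2" for x y :: complex
      using sum_diff_eq_iff[of y x e1 e2] by (auto simp: add.commute)
    from this[of "A * (W - 1)" "B * (W - \<omega>\<^sup>2) / \<omega>"]
    have "A * (W - 1) + B * (W - \<omega>\<^sup>2) / \<omega> = e1 \<and> - A * (W - 1) + B * (W - \<omega>\<^sup>2) / \<omega> = e2 \<longleftrightarrow>
        A * (W - 1) = (e1 - e2) / 2 \<and> B * (W - \<omega>\<^sup>2) / \<omega> = (e1 + e2) / 2"
      by simp
    moreover have "A * (W - 1) = (e1 - e2) / 2 \<longleftrightarrow> A = (e1 - e2) / (2 * (W - 1))"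
      using assms(6) by (intro mult_eq_half_iff) simp
    moreover have "B * (W - \<omega>\<^sup>2) / \<omega> = (e1 + e2) / 2 \<longleftrightarrow> B = (e1 + e2) * \<omega> / (2 * (W - \<omega>\<^sup>2))"
      using \<omega>_nz assms(7) by (intro mult_divide_eq_half_iff) simp_all
    ultimately show ?thesis unfolding 3 4 by simp
  qed
  ultimately show ?thesis by blast
qed

text \<open>For odd \<open>m\<close> the exponents pair differently: \<open>A\<close> goes with
  \<open>C\<close> and \<open>B\<close> with \<open>D\<close>. Both unknowns then share the divisor
  \<open>W - \<omega>\<close>, and the remaining 2 by 2 system has determinant
  \<open>- (1 + \<omega>\<^sup>2)\<close>, which is nonzero.\<close>

lemma biharm_odd_iff:
  fixes A B C D b1 b2 b3 b4 W :: complex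
  defines "s \<equiv> (b1 + b2) / 2" and "d \<equiv> (b1 - b2) / 2"
  defines "e1 \<equiv> b3 - s - d * \<omega>" and "e2 \<equiv> b4 * W - s * W + d * W / \<omega>"
  assumes "W \<noteq> 0" "W \<noteq> \<omega>"
  shows "(A + B + C + D = b1 \<and> - A + B - C + D = b2 \<and> A * W + B * W / \<omega> + C * \<omega> + D = b3
      \<and> - A / W + B * \<omega> / W - C / \<omega> + D = b4) \<longleftrightarrow>
    (A = (\<omega> * e1 + e2) * \<omega> / ((W - \<omega>) * (1 + \<omega>\<^sup>2)) \<and> B = (e1 - \<omega> * e2) * \<omega> / ((W - \<omega>) * (1 + \<omega>\<^sup>2))
      \<and> C = d - A \<and> D = s - B)"
proof -
  have "A + B + C + D = (B + D) + (A + C)" "- A + B - C + D = (B + D) - (A + C)" by simp_all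
  then have "A + B + C + D = b1 \<and> - A + B - C + D = b2 \<longleftrightarrow> B + D = s \<and> A + C = d"
    unfolding s_def d_def by (simp only: sum_diff_eq_iff)
  also have "\<dots> \<longleftrightarrow> C = d - A \<and> D = s - B" by (auto simp: algebra_simps)
  finally have "A + B + C + D = b1 \<and> - A + B - C + D = b2 \<longleftrightarrow> C = d - A \<and> D = s - B" .
  moreover have "A * W + B * W / \<omega> + C * \<omega> + D = b3 \<and> - A / W + B * \<omega> / W - C / \<omega> + D = b4
     \<longleftrightarrow> A = (\<omega> * e1 + e2) * \<omega> / ((W - \<omega>) * (1 + \<omega>\<^sup>2)) \<and> B = (e1 - \<omega> * e2) * \<omega> / ((W - \<omega>) * (1 + \<omega>\<^sup>2))"
    if CD: "C = d - A" "D = s - B"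
  proof -
    define k where "k = (W - \<omega>) / \<omega>"
    have "A * W + B * W / \<omega> + C * \<omega> + D = \<omega> * (k * A) + k * B + (s + d * \<omega>)"
      using \<omega>_nz by (simp add: CD k_def field_simps)
    then have 3: "A * W + B * W / \<omega> + C * \<omega> + D = b3 \<longleftrightarrow> \<omega> * (k * A) + k * B = e1"
      unfolding e1_def by (auto simp: algebra_simps)
    have "- A / W + B * \<omega> / W - C / \<omega> + D = b4 \<longleftrightarrow> (- A / W + B * \<omega> / W - C / \<omega> + D) * W = b4 * W"
      using assms by simp
    also have "(- A / W + B * \<omega> / W - C / \<omega> + D) * W = k * A - \<omega> * (k * B) + (s * W - d * W / \<omega>)"
      using \<omega>_nz assms by (simp add: CD k_def field_simps power2_eq_square)
    also have "\<dots> = b4 * W \<longleftrightarrow> k * A - \<omega> * (k * B) = e2"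
      unfolding e2_def by (auto simp: algebra_simps)
    finally have 4: "- A / W + B * \<omega> / W - C / \<omega> + D = b4 \<longleftrightarrow> k * A - \<omega> * (k * B) = e2" .
    have "\<omega> * x + y = e1 \<and> x - \<omega> * y = e2 \<longleftrightarrow>
        x * (1 + \<omega>\<^sup>2) = \<omega> * e1 + e2 \<and> y * (1 + \<omega>\<^sup>2) = e1 - \<omega> * e2" for x y :: complex
    proof
      assume *: "x * (1 + \<omega>\<^sup>2) = \<omega> * e1 + e2 \<and> y * (1 + \<omega>\<^sup>2) = e1 - \<omega> * e2"
      \<comment> \<open>Both equations are checked after multiplication by the nonzero
        \<open>1 + \<omega>\<^sup>2\<close>.\<close>
      have "(\<omega> * x + y) * (1 + \<omega>\<^sup>2) = \<omega> * (x * (1 + \<omega>\<^sup>2)) + y * (1 + \<omega>\<^sup>2)"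
        "(x - \<omega> * y) * (1 + \<omega>\<^sup>2) = x * (1 + \<omega>\<^sup>2) - \<omega> * (y * (1 + \<omega>\<^sup>2))"
        by (simp_all add: algebra_simps)
      then have "(\<omega> * x + y) * (1 + \<omega>\<^sup>2) = e1 * (1 + \<omega>\<^sup>2)" "(x - \<omega> * y) * (1 + \<omega>\<^sup>2) = e2 * (1 + \<omega>\<^sup>2)"
        unfolding conjunct1[OF *] conjunct2[OF *] by (simp_all add: algebra_simps power2_eq_square)
      then show "\<omega> * x + y = e1 \<and> x - \<omega> * y = e2" using \<omega>_sq by simp
    qed (auto simp: algebra_simps power2_eq_square)
    from this[of "k * A" "k * B"]
    moreover have "k * x * (1 + \<omega>\<^sup>2) = e \<longleftrightarrow> x = e * \<omega> / ((W - \<omega>) * (1 + \<omega>\<^sup>2))" for x e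
      unfolding k_def using \<omega>_nz \<omega>_sq(2) assms(6) by (intro quotient_mult_eq_iff) simp_all
    ultimately show ?thesis unfolding 3 4 by simp
  qed
  ultimately show ?thesis by blast
qed

lemma W_neq:
  fixes m :: nat
  shows "\<omega> ^ (m + 4) \<noteq> 0" "\<omega> ^ (m + 4) \<noteq> 1" "\<omega> ^ (m + 4) \<noteq> \<omega>\<^sup>2" "\<omega> ^ (m + 4) \<noteq> \<omega>"
proof -
  have "\<omega> ^ (m + 4) = \<omega>\<^sup>2 * \<omega> ^ (m + 2)" "\<omega> ^ (m + 4) = \<omega> * \<omega> ^ (m + 3)"
    by (simp_all add: power_add power2_eq_square power3_eq_cube power4_eq_xxxx)
  then show "\<omega> ^ (m + 4) \<noteq> 0" "\<omega> ^ (m + 4) \<noteq> 1" "\<omega> ^ (m + 4) \<noteq> \<omega>\<^sup>2" "\<omega> ^ (m + 4) \<noteq> \<omega>"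
    using \<omega>_nz \<omega>_pow_neq[of "m + 4"] \<omega>_pow_neq[of "m + 2"] \<omega>_pow_neq[of "m + 3"] by auto
qed

lemma biharm_eq_0:
  assumes "poly (biharm m A B C D) 1 = 0" "poly (biharm m A B C D) (-1) = 0"
    "poly (biharm m A B C D) \<omega> = 0" "poly (biharm m A B C D) (- 1 / \<omega>) = 0"
  shows "biharm m A B C D = 0"
proof (cases "even m")
  case True
  then show ?thesis
    using biharm_even_iff[OF W_neq(1-3)[of m], of A B C D 0 0 0 0] assms unfolding poly_biharm
    by (simp add: biharm_def)
next
  case False
  then show ?thesis
    using biharm_odd_iff[OF W_neq(1,4)[of m], of A B C D 0 0 0 0] assms unfolding poly_biharm
    by (simp add: biharm_def)
qed

text \<open>Up to a factor of modulus 1 the three divisors are \<open>\<omega> ^ n - 1\<close> with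
  \<open>n\<close> equal to \<open>m + 4\<close>, \<open>m + 2\<close> and \<open>m + 3\<close>; the
  worst exponent serves for all.\<close>

lemma W_bounds:
  fixes m :: nat
  shows "inverse (norm (\<omega> ^ (m + 4) - 1)) \<le> real (m + 4) / \<delta>"
    "inverse (norm (\<omega> ^ (m + 4) - \<omega>\<^sup>2)) \<le> real (m + 4) / \<delta>"
    "inverse (norm (\<omega> ^ (m + 4) - \<omega>)) \<le> real (m + 4) / \<delta>"
proof -
  have *: "inverse (norm (\<omega> ^ n - 1)) \<le> real (m + 4) / \<delta>" if "n > 0" "n \<le> m + 4" for n
  proof -
    have "\<delta> / real (m + 4) \<le> \<delta> / real n" using that \<delta>_pos by (intro divide_left_mono) auto
    also have "\<dots> \<le> norm (\<omega> ^ n - 1)" by (rule small_div[OF that(1)])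
    finally have "inverse (norm (\<omega> ^ n - 1)) \<le> inverse (\<delta> / real (m + 4))"
      using \<delta>_pos by (intro le_imp_inverse_le) auto
    then show ?thesis by simp
  qed
  have "\<omega> ^ (m + 4) - \<omega>\<^sup>2 = \<omega>\<^sup>2 * (\<omega> ^ (m + 2) - 1)" "\<omega> ^ (m + 4) - \<omega> = \<omega> * (\<omega> ^ (m + 3) - 1)"
    by (simp_all add: power_add power2_eq_square power3_eq_cube power4_eq_xxxx algebra_simps)
  then have "norm (\<omega> ^ (m + 4) - \<omega>\<^sup>2) = norm (\<omega> ^ (m + 2) - 1)" "norm (\<omega> ^ (m + 4) - \<omega>) = norm (\<omega> ^ (m + 3) - 1)"
    by (simp_all add: norm_mult norm_power norm_\<omega>)
  then show "inverse (norm (\<omega> ^ (m + 4) - 1)) \<le> real (m + 4) / \<delta>"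
    "inverse (norm (\<omega> ^ (m + 4) - \<omega>\<^sup>2)) \<le> real (m + 4) / \<delta>"
    "inverse (norm (\<omega> ^ (m + 4) - \<omega>)) \<le> real (m + 4) / \<delta>"
    using *[of "m + 4"] *[of "m + 2"] *[of "m + 3"] by simp_all
qed

text \<open>The factor 6 bounds combinations of \<open>e1\<close> and \<open>e2\<close>, each of
  norm at most \<open>3 * M\<close> in \<open>biharm_interpolation\<close>. The summand 1 serves
  even degrees, the other one odd degrees, where \<open>1 + \<omega>\<^sup>2\<close> is an extra
  divisor.\<close>

definition K\<^sub>0 :: real where "K\<^sub>0 = 6 * (1 + inverse (norm (1 + \<omega>\<^sup>2))) / \<delta>"

lemma K\<^sub>0_pos: "K\<^sub>0 > 0"
  using \<delta>_pos by (auto simp: K\<^sub>0_def intro!: mult_pos_pos divide_pos_pos add_pos_nonneg)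

text \<open>The explicit solutions of the two linear systems, estimated through the small divisors:
  interpolation costs one factor of order \<open>m\<close>.\<close>

lemma biharm_interpolation:
  assumes b: "norm b1 \<le> M" "norm b2 \<le> M" "norm b3 \<le> M" "norm b4 \<le> M"
  obtains A B C D where
    "poly (biharm m A B C D) 1 = b1" "poly (biharm m A B C D) (-1) = b2"
    "poly (biharm m A B C D) \<omega> = b3" "poly (biharm m A B C D) (- 1 / \<omega>) = b4"
    "pnorm (biharm m A B C D) \<le> 2 * M + 4 * K\<^sub>0 * real (m + 4) * M"
proof -
  note result = that
  define W where "W = \<omega> ^ (m + 4)"
  define s d where "s = (b1 + b2) / 2" and "d = (b1 - b2) / 2"
  define e1 e2 where "e1 = b3 - s - d * \<omega>" and "e2 = b4 * W - s * W + d * W / \<omega>"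
  have nW: "norm W = 1" by (simp add: W_def norm_power norm_\<omega>)
  have M: "0 \<le> M" using b(1) norm_ge_zero order_trans by blast
  have sd: "norm s \<le> M" "norm d \<le> M"
    using norm_triangle_ineq[of b1 b2] norm_triangle_ineq4[of b1 b2] b
    by (auto simp: s_def d_def norm_divide)
  have e1: "norm e1 \<le> 3 * M"
    unfolding e1_def
    using norm_triangle_ineq4[of "b3 - s" "d * \<omega>"] norm_triangle_ineq4[of b3 s] sd b
    by (simp add: norm_mult norm_\<omega>)
  have e2: "norm e2 \<le> 3 * M"
    unfolding e2_def
    using norm_triangle_ineq[of "b4 * W - s * W" "d * W / \<omega>"] norm_triangle_ineq4[of "b4 * W" "s * W"] sd b
    by (simp add: norm_mult norm_divide norm_\<omega> nW)
  have K: "6 * M * (real (m + 4) / \<delta>) \<le> K\<^sub>0 * real (m + 4) * M"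
    "6 * M * (real (m + 4) / \<delta>) * inverse (norm (1 + \<omega>\<^sup>2)) \<le> K\<^sub>0 * real (m + 4) * M"
  proof -
    have "K\<^sub>0 * real (m + 4) * M = 6 * M * (real (m + 4) / \<delta>) + 6 * M * (real (m + 4) / \<delta>) * inverse (norm (1 + \<omega>\<^sup>2))"
      unfolding K\<^sub>0_def by (simp add: algebra_simps add_divide_distrib)
    moreover have "0 \<le> 6 * M * (real (m + 4) / \<delta>)" "0 \<le> 6 * M * (real (m + 4) / \<delta>) * inverse (norm (1 + \<omega>\<^sup>2))"
      using M \<delta>_pos by auto
    ultimately show "6 * M * (real (m + 4) / \<delta>) \<le> K\<^sub>0 * real (m + 4) * M"
    "6 * M * (real (m + 4) / \<delta>) * inverse (norm (1 + \<omega>\<^sup>2)) \<le> K\<^sub>0 * real (m + 4) * M" by linarith+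
  qed
  have quot: "norm (x * inverse y) \<le> 6 * M * (real (m + 4) / \<delta>)"
    if "norm x \<le> 6 * M" "inverse (norm y) \<le> real (m + 4) / \<delta>" for x y :: complex
    using mult_mono[OF that] M by (simp add: norm_mult norm_inverse)
  have half: "x / (2 * k) = x / 2 * inverse k" for x k :: complex
    by (cases "k = 0") (simp_all add: field_simps)
  \<comment> \<open>Common end for both parities: in either pairing \<open>C\<close> and
    \<open>D\<close> differ from \<open>d\<close> and \<open>s\<close> by \<open>A\<close> and
    \<open>B\<close>, so bounds for \<open>A\<close> and \<open>B\<close> suffice.\<close>
  have fin: thesis
    if "poly (biharm m A B C D) 1 = b1" "poly (biharm m A B C D) (-1) = b2"
    "poly (biharm m A B C D) \<omega> = b3" "poly (biharm m A B C D) (- 1 / \<omega>) = b4"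
    "norm A \<le> K\<^sub>0 * real (m + 4) * M" "norm B \<le> K\<^sub>0 * real (m + 4) * M"
    "C = d - A \<and> D = s - B \<or> C = d - B \<and> D = s - A"
    for A B C D
  proof (rule result[OF that(1-4)])
    have "norm C + norm D \<le> 2 * M + norm A + norm B"
      using that(7) sd norm_triangle_ineq4[of d A] norm_triangle_ineq4[of d B]
        norm_triangle_ineq4[of s A] norm_triangle_ineq4[of s B] by auto
    moreover have "pnorm (biharm m A B C D) \<le> norm A + norm B + norm C + norm D"
      unfolding biharm_def
      using pnorm_add[of "monom A (m + 4) + monom B (m + 3)" "[:D, C:]"]
        pnorm_add[of "monom A (m + 4)" "monom B (m + 3)"] by simp
    ultimately show "pnorm (biharm m A B C D) \<le> 2 * M + 4 * K\<^sub>0 * real (m + 4) * M"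
      using that(5,6) by linarith
  qed
  show thesis
  proof (cases "even m")
    case True
    define A B where "A = (e1 - e2) / (2 * (W - 1))" and "B = (e1 + e2) * \<omega> / (2 * (W - \<omega>\<^sup>2))"
    have "norm A \<le> 6 * M * (real (m + 4) / \<delta>)"
    proof -
      have "A = (e1 - e2) / 2 * inverse (W - 1)"
        unfolding A_def by (rule half)
      moreover have "norm ((e1 - e2) / 2) \<le> 6 * M"
        using norm_triangle_ineq4[of e1 e2] e1 e2 M by (simp add: norm_divide)
      ultimately show ?thesis
        using quot[of "(e1 - e2) / 2" "W - 1"] W_bounds(1)[of m] by (simp only: W_def)
    qed
    moreover have "norm B \<le> 6 * M * (real (m + 4) / \<delta>)"
    proof -
      have "B = (e1 + e2) * \<omega> / 2 * inverse (W - \<omega>\<^sup>2)"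
        unfolding B_def by (rule half)
      moreover have "norm ((e1 + e2) * \<omega> / 2) \<le> 6 * M"
        using norm_triangle_ineq[of e1 e2] e1 e2 M by (simp add: norm_divide norm_mult norm_\<omega>)
      ultimately show ?thesis
        using quot[of "(e1 + e2) * \<omega> / 2" "W - \<omega>\<^sup>2"] W_bounds(2)[of m] by (simp only: W_def)
    qed
    ultimately have AB: "norm A \<le> K\<^sub>0 * real (m + 4) * M" "norm B \<le> K\<^sub>0 * real (m + 4) * M"
      using K(1) by linarith+
    have "A + B + (d - B) + (s - A) = b1 \<and> A - B - (d - B) + (s - A) = b2
      \<and> A * W + B * W / \<omega> + (d - B) * \<omega> + (s - A) = b3
      \<and> A / W - B * \<omega> / W - (d - B) / \<omega> + (s - A) = b4"
      by (rule iffD2[OF biharm_even_iff[OF W_neq(1-3)[of m, folded W_def]]])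
        (simp only: A_def B_def e1_def e2_def s_def d_def simp_thms)
    then show thesis
      using True AB by (intro fin[of A B "d - B" "s - A"]) (simp_all only: poly_biharm W_def if_True simp_thms)
  next
    case False
    define A B where "A = (\<omega> * e1 + e2) * \<omega> / ((W - \<omega>) * (1 + \<omega>\<^sup>2))"
      and "B = (e1 - \<omega> * e2) * \<omega> / ((W - \<omega>) * (1 + \<omega>\<^sup>2))"
    have *: "norm (x * \<omega> / ((W - \<omega>) * (1 + \<omega>\<^sup>2))) \<le> K\<^sub>0 * real (m + 4) * M" if "norm x \<le> 6 * M" for x
    proof -
      have "norm (x * \<omega> * inverse (W - \<omega>)) \<le> 6 * M * (real (m + 4) / \<delta>)"
        using W_bounds(3)[of m] that by (intro quot) (simp_all add: norm_mult norm_\<omega> W_def)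
      then have "norm (x * \<omega> * inverse (W - \<omega>)) * inverse (norm (1 + \<omega>\<^sup>2))
          \<le> 6 * M * (real (m + 4) / \<delta>) * inverse (norm (1 + \<omega>\<^sup>2))"
        by (intro mult_right_mono) auto
      also have "norm (x * \<omega> * inverse (W - \<omega>)) * inverse (norm (1 + \<omega>\<^sup>2)) = norm (x * \<omega> / ((W - \<omega>) * (1 + \<omega>\<^sup>2)))"
        by (simp only: norm_mult norm_divide norm_inverse divide_inverse inverse_mult_distrib mult.assoc)
      finally show ?thesis using K(2) by linarith
    qed
    have "norm A \<le> K\<^sub>0 * real (m + 4) * M"
      unfolding A_def using norm_triangle_ineq[of "\<omega> * e1" e2] e1 e2
      by (intro *) (simp add: norm_mult norm_\<omega>)
    moreover have "norm B \<le> K\<^sub>0 * real (m + 4) * M"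
      unfolding B_def using norm_triangle_ineq4[of e1 "\<omega> * e2"] e1 e2
      by (intro *) (simp add: norm_mult norm_\<omega>)
    moreover have "A + B + (d - A) + (s - B) = b1 \<and> - A + B - (d - A) + (s - B) = b2
      \<and> A * W + B * W / \<omega> + (d - A) * \<omega> + (s - B) = b3
      \<and> - A / W + B * \<omega> / W - (d - A) / \<omega> + (s - B) = b4"
      by (rule iffD2[OF biharm_odd_iff[OF W_neq(1,4)[of m, folded W_def]]])
        (simp only: A_def B_def e1_def e2_def s_def d_def simp_thms)
    ultimately show thesis
      using False by (intro fin[of A B "d - A" "s - B"]) (simp_all only: poly_biharm W_def if_False simp_thms)
  qed
qed

text \<open>The roots are the values of \<open>z / cnj z\<close> on the lines \<open>y = 0\<close>,
  \<open>x = 0\<close>, \<open>x = t * y\<close> and \<open>x = y / t\<close> when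
  \<open>\<omega> = (t + \<i>) / (t - \<i>)\<close>.\<close>

definition Q :: "complex poly" where
  "Q = [:-1, 1:] * ([:1, 1:] * ([:-\<omega>, 1:] * [:1 / \<omega>, 1:]))"

text \<open>The four roots are distinct because \<open>\<omega>\<^sup>2\<close> is neither 1 nor -1,
  so the linear factors can be split off one at a time.\<close>

lemma Q_dvd_iff:
  "Q dvd u \<longleftrightarrow> poly u 1 = 0 \<and> poly u (-1) = 0 \<and> poly u \<omega> = 0 \<and> poly u (- 1 / \<omega>) = 0"
proof
  assume "Q dvd u"
  then obtain q where "u = Q * q" by (auto elim: dvdE)
  then show "poly u 1 = 0 \<and> poly u (-1) = 0 \<and> poly u \<omega> = 0 \<and> poly u (- 1 / \<omega>) = 0"
    by (simp add: Q_def del: mult_pCons_left mult_pCons_right)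
next
  assume u: "poly u 1 = 0 \<and> poly u (-1) = 0 \<and> poly u \<omega> = 0 \<and> poly u (- 1 / \<omega>) = 0"
  have "\<omega> \<noteq> 1" "\<omega> \<noteq> -1" using \<omega>_sq by auto
  then have ne: "\<omega> - 1 \<noteq> 0" "\<omega> + 1 \<noteq> 0" by (auto simp: eq_neg_iff_add_eq_0)
  have ne2: "- 1 / \<omega> - 1 \<noteq> 0" "- 1 / \<omega> + 1 \<noteq> 0" "- 1 / \<omega> - \<omega> \<noteq> 0"
  proof -
    have "- 1 / \<omega> - 1 = - (\<omega> + 1) / \<omega>" "- 1 / \<omega> + 1 = (\<omega> - 1) / \<omega>" "- 1 / \<omega> - \<omega> = - (1 + \<omega>\<^sup>2) / \<omega>"
      using \<omega>_nz by (simp_all add: field_simps power2_eq_square)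
    then show "- 1 / \<omega> - 1 \<noteq> 0" "- 1 / \<omega> + 1 \<noteq> 0" "- 1 / \<omega> - \<omega> \<noteq> 0"
      using ne \<omega>_nz \<omega>_sq by (auto simp only: divide_eq_0_iff neg_equal_0_iff_equal)
  qed
  obtain q1 where q1: "u = [:-1, 1:] * q1" using u poly_eq_0_iff_dvd[of u 1] by (auto elim: dvdE)
  then have "poly q1 (-1) = 0" using u by (simp add: q1)
  then obtain q2 where q2: "q1 = [:1, 1:] * q2" using poly_eq_0_iff_dvd[of q1 "-1"] by (auto elim: dvdE)
  have "poly u \<omega> = (\<omega> - 1) * ((\<omega> + 1) * poly q2 \<omega>)" by (simp add: q1 q2 algebra_simps)
  then have "poly q2 \<omega> = 0" using u ne by simp
  then obtain q3 where q3: "q2 = [:-\<omega>, 1:] * q3" using poly_eq_0_iff_dvd[of q2 \<omega>] by (auto elim: dvdE)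
  define y where "y = - 1 / \<omega>"
  have "poly u y = (y - 1) * ((y + 1) * ((y - \<omega>) * poly q3 y))"
    by (simp add: q1 q2 q3 algebra_simps)
  moreover have "poly u y = 0" using u by (simp only: y_def)
  ultimately have "poly q3 y = 0" using ne2[folded y_def] by simp
  then obtain q4 where q4: "q3 = [:- y, 1:] * q4" using poly_eq_0_iff_dvd[of q3 y] by (auto elim: dvdE)
  have "u = Q * q4" by (simp add: q1 q2 q3 q4 y_def Q_def mult_ac del: mult_pCons_left mult_pCons_right)
  then show "Q dvd u" by simp
qed

text \<open>A particular solution, small by \<open>1 / (m + 1)\<^sup>2\<close>, is corrected by a
  biharmonic form that cancels its values at the roots. The correction costs a factor of order
  \<open>m\<close>, so a gain of one power of the degree remains.\<close>

lemma bilap_hom_solve: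
  assumes "degree h \<le> m"
  obtains u where "degree u \<le> m + 4" "bilap_hom m u = h" "Q dvd u"
    "pnorm u \<le> (3 + 16 * K\<^sub>0) / real (m + 1) * pnorm h"
proof -
  obtain v where v: "degree v \<le> m + 4" "bilap_hom m v = h" "pnorm v \<le> pnorm h / (real (m + 1))\<^sup>2"
    using bilap_hom_right_inverse[OF assms] .
  have "norm (- poly v z) \<le> pnorm v" if "norm z = 1" for z
    using norm_poly_le_pnorm[OF that, of v] by simp
  from this[of 1] this[of "-1"] this[of \<omega>] this[of "- 1 / \<omega>"]
  have b: "norm (- poly v 1) \<le> pnorm v" "norm (- poly v (-1)) \<le> pnorm v"
    "norm (- poly v \<omega>) \<le> pnorm v" "norm (- poly v (- 1 / \<omega>)) \<le> pnorm v"
    by (simp_all add: norm_divide norm_\<omega>)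
  obtain A B C D where
    p: "poly (biharm m A B C D) 1 = - poly v 1" "poly (biharm m A B C D) (-1) = - poly v (-1)"
    "poly (biharm m A B C D) \<omega> = - poly v \<omega>" "poly (biharm m A B C D) (- 1 / \<omega>) = - poly v (- 1 / \<omega>)"
    "pnorm (biharm m A B C D) \<le> 2 * pnorm v + 4 * K\<^sub>0 * real (m + 4) * pnorm v"
    using biharm_interpolation[OF b] by blast
  show thesis
  proof
    show "degree (v + biharm m A B C D) \<le> m + 4" by (intro degree_add_le v degree_biharm)
    show "bilap_hom m (v + biharm m A B C D) = h" by (simp add: bilap_hom_add v bilap_hom_biharm)
    show "Q dvd v + biharm m A B C D" unfolding Q_dvd_iff poly_add p by simp
    have "pnorm (v + biharm m A B C D) \<le> (3 + 4 * K\<^sub>0 * real (m + 4)) * pnorm v"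
      using pnorm_add[of v "biharm m A B C D"] p(5) by (simp add: algebra_simps)
    also have "\<dots> \<le> ((3 + 16 * K\<^sub>0) * real (m + 1)) * pnorm v"
    proof (intro mult_right_mono)
      \<comment> \<open>Here \<open>m + 4 \<le> 4 * (m + 1)\<close> turns the constant 4 into
        16.\<close>
      have "K\<^sub>0 * real (m + 4) \<le> K\<^sub>0 * (4 * real (m + 1))" using K\<^sub>0_pos by (intro mult_left_mono) auto
      then show "3 + 4 * K\<^sub>0 * real (m + 4) \<le> (3 + 16 * K\<^sub>0) * real (m + 1)" by (simp add: algebra_simps)
    qed simp
    also have "\<dots> \<le> ((3 + 16 * K\<^sub>0) * real (m + 1)) * (pnorm h / (real (m + 1))\<^sup>2)"
      using K\<^sub>0_pos by (intro mult_left_mono v) auto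
    also have "\<dots> = (3 + 16 * K\<^sub>0) / real (m + 1) * pnorm h"
      by (simp add: power2_eq_square)
    finally show "pnorm (v + biharm m A B C D) \<le> (3 + 16 * K\<^sub>0) / real (m + 1) * pnorm h" .
  qed
qed

lemma bilap_hom_unique:
  assumes "degree u \<le> m + 4" "bilap_hom m u = 0" "Q dvd u"
  shows "u = 0"
  using biharm_eq_0 eq_biharm_if_bilap_hom_eq_0[OF assms(1,2)] assms(3) unfolding Q_dvd_iff by metis

end

section \<open>The cost of dividing by \<open>Q\<close>\<close>

lemma pnorm_linear_factor:
  assumes "norm \<omega> = 1" "degree q \<le> n"
  shows "pnorm q \<le> real (n + 1) * pnorm ([:- \<omega>, 1:] * q)"
proof -
  define p where "p = [:- \<omega>, 1:] * q"
  have c0: "coeff p 0 = - \<omega> * coeff q 0" and cS: "coeff p (Suc k) = coeff q k - \<omega> * coeff q (Suc k)" for k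
    by (simp_all add: p_def)
  have dp: "degree p \<le> n + 1"
    unfolding p_def using degree_mult_le[of "[:- \<omega>, 1:]" q] assms(2) by simp
  \<comment> \<open>Read off from the constant coefficient upwards, each coefficient of
    \<open>q\<close> is the previous one minus one of \<open>p\<close>, up to a factor of modulus 1;
    the norms therefore only add up.\<close>
  have "norm (coeff q k) \<le> (\<Sum>i\<le>k. norm (coeff p i))" for k
  proof (induction k)
    case 0
    then show ?case by (simp add: c0 norm_mult assms)
  next
    case (Suc k)
    have "norm (coeff q (Suc k)) = norm (\<omega> * coeff q (Suc k))" by (simp add: norm_mult assms)
    also have "\<omega> * coeff q (Suc k) = coeff q k - coeff p (Suc k)" by (simp add: cS)
    also have "norm \<dots> \<le> norm (coeff q k) + norm (coeff p (Suc k))" by (rule norm_triangle_ineq4)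
    finally show ?case using Suc.IH by simp
  qed
  also have "(\<Sum>i\<le>k. norm (coeff p i)) \<le> pnorm p" if "k \<le> n" for k
    unfolding pnorm_eq_sum[OF dp] using that by (intro sum_mono2) auto
  finally have "norm (coeff q k) \<le> pnorm p" if "k \<le> n" for k using that by blast
  then have "(\<Sum>k\<le>n. norm (coeff q k)) \<le> (\<Sum>k\<le>n. pnorm p)" by (intro sum_mono) auto
  then show ?thesis unfolding p_def[symmetric] pnorm_eq_sum[OF assms(2)] by simp
qed

text \<open>Four linear factors with roots on the unit circle; each costs at most
  \<open>m + 4 \<le> 4 * (m + 1)\<close>, and \<open>4 ^ 4 = 256\<close>.\<close>

lemma (in small_divisors) pnorm_le_Q_mult:
  assumes "degree q \<le> m"
  shows "pnorm q \<le> 256 * real (m + 1) ^ 4 * pnorm (Q * q)"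
proof -
  have step: "pnorm r \<le> 4 * real (m + 1) * pnorm ([:- z, 1:] * r) \<and> degree ([:- z, 1:] * r) \<le> n + 1"
    if "norm z = 1" "degree r \<le> n" "n \<le> m + 3" for z r n
  proof
    have "pnorm r \<le> real (n + 1) * pnorm ([:- z, 1:] * r)"
      by (rule pnorm_linear_factor[OF that(1,2)])
    also have "\<dots> \<le> 4 * real (m + 1) * pnorm ([:- z, 1:] * r)"
      using that(3) by (intro mult_right_mono) auto
    finally show "pnorm r \<le> 4 * real (m + 1) * pnorm ([:- z, 1:] * r)" .
    show "degree ([:- z, 1:] * r) \<le> n + 1"
      using degree_mult_le[of "[:- z, 1:]" r] that(2) by simp
  qed
  define r1 where "r1 = [:- (- 1 / \<omega>), 1:] * q"
  define r2 where "r2 = [:- \<omega>, 1:] * r1"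
  define r3 where "r3 = [:- (- 1), 1:] * r2"
  define r4 where "r4 = [:- 1, 1:] * r3"
  have 1: "pnorm q \<le> 4 * real (m + 1) * pnorm r1 \<and> degree r1 \<le> m + 1"
    unfolding r1_def by (rule step) (auto simp: norm_divide norm_\<omega> assms)
  have 2: "pnorm r1 \<le> 4 * real (m + 1) * pnorm r2 \<and> degree r2 \<le> m + 1 + 1"
    unfolding r2_def by (rule step) (use 1 in \<open>auto simp: norm_\<omega>\<close>)
  have 3: "pnorm r2 \<le> 4 * real (m + 1) * pnorm r3 \<and> degree r3 \<le> m + 1 + 1 + 1"
    unfolding r3_def by (rule step) (use 2 in auto)
  have 4: "pnorm r3 \<le> 4 * real (m + 1) * pnorm r4 \<and> degree r4 \<le> m + 1 + 1 + 1 + 1"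
    unfolding r4_def by (rule step) (use 3 in auto)
  have r4: "r4 = Q * q" by (simp add: r1_def r2_def r3_def r4_def Q_def mult_ac del: mult_pCons_left mult_pCons_right)
  define X where "X = 4 * real (m + 1)"
  have X: "X \<ge> 0" by (simp add: X_def)
  have *: "4 * a * (4 * a * (4 * a * (4 * a * b))) = 256 * a ^ 4 * b" for a b :: real
    by (simp add: power4_eq_xxxx)
  have "pnorm q \<le> X * (X * (X * (X * pnorm r4)))"
    using 1 2 3 4 X unfolding X_def[symmetric] by (meson mult_left_mono order_trans)
  also have "\<dots> = 256 * real (m + 1) ^ 4 * pnorm r4" by (simp only: X_def *)
  finally show ?thesis by (simp only: r4)
qed

text \<open>At any radius below \<open>R\<close> the factor \<open>1 / (m + 1)\<close> eventually
  makes the convolution term a contraction, so the terms stay bounded there. Hence no part of the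
  disc is lost.\<close>

lemma summable_below_recursion:
  fixes W H c :: "nat \<Rightarrow> real"
  assumes W0: "\<And>n. 0 \<le> W n" and H0: "\<And>n. 0 \<le> H n" and c0: "\<And>n. 0 \<le> c n" and K: "0 \<le> K"
    and rec: "\<And>m. W (m + 4) \<le> K / real (m + 1) * (H m + (\<Sum>i\<le>m. c i * W (m - i)))"
    and H: "summable_below R H" and c: "summable_below R c"
  shows "summable_below R W"
proof (rule summable_below_of_bounded_terms)
  fix \<rho> :: real assume \<rho>: "0 < \<rho>" "ereal \<rho> < R"
  note sH = summable_belowD[OF H \<rho>] and sc = summable_belowD[OF c \<rho>]
  define h where "h = (\<Sum>m. H m * \<rho> ^ m)"
  define g where "g = (\<Sum>m. c m * \<rho> ^ m)"
  have h: "H m * \<rho> ^ m \<le> h" for m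
    using sum_le_suminf[OF sH, of "{m}"] H0 \<rho>(1) by (simp add: h_def)
  have g: "(\<Sum>i\<le>m. c i * \<rho> ^ i) \<le> g" for m
    using sum_le_suminf[OF sc, of "{..m}"] c0 \<rho>(1) by (simp add: g_def)
  have h0: "0 \<le> h" unfolding h_def using sH H0 \<rho>(1) by (intro suminf_nonneg) auto
  \<comment> \<open>\<open>M\<close> is chosen so that the convolution coefficient
    \<open>K * \<rho> ^ 4 * g / (m + 1)\<close> is at most \<open>1 / 2\<close> for
    \<open>m \<ge> M\<close>.\<close>
  obtain M :: nat where M: "2 * K * \<rho> ^ 4 * g \<le> real M" using real_arch_simple by blast
  define x where "x n = W n * \<rho> ^ n" for n
  have x0: "0 \<le> x n" for n using W0 \<rho>(1) by (simp add: x_def)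
  \<comment> \<open>The sum covers the initial terms; the second summand makes
    \<open>K * \<rho> ^ 4 * h + X / 2 \<le> X\<close>.\<close>
  define X where "X = (\<Sum>n\<le>M + 4. x n) + 2 * K * \<rho> ^ 4 * h"
  have Kh: "0 \<le> K * \<rho> ^ 4 * h" using K h0 \<rho>(1) by simp
  have S0: "0 \<le> (\<Sum>n\<le>M + 4. x n)" by (intro sum_nonneg x0)
  have X0: "0 \<le> X" using Kh S0 unfolding X_def by linarith
  have bd: "x n \<le> X" for n
  proof (induction n rule: less_induct)
    case (less n)
    show ?case
    proof (cases "n \<le> M + 4")
      case True
      then have "x n \<le> (\<Sum>n\<le>M + 4. x n)" by (intro member_le_sum) (auto simp: x0)
      then show ?thesis using Kh unfolding X_def by linarith
    next
      case False
      define m where "m = n - 4"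
      have n: "n = m + 4" and m: "M \<le> m" using False by (auto simp: m_def)
      have "x n \<le> K / real (m + 1) * (H m + (\<Sum>i\<le>m. c i * W (m - i))) * \<rho> ^ n"
        unfolding x_def n using rec[of m] \<rho>(1) by (intro mult_right_mono) auto
      also have "\<dots> = K * \<rho> ^ 4 / real (m + 1) * (H m * \<rho> ^ m + (\<Sum>i\<le>m. c i * W (m - i)) * \<rho> ^ m)"
        by (simp add: n power_add algebra_simps)
      also have "(\<Sum>i\<le>m. c i * W (m - i)) * \<rho> ^ m = (\<Sum>i\<le>m. (c i * \<rho> ^ i) * x (m - i))"
        unfolding sum_distrib_right x_def
        by (intro sum.cong) (auto simp: algebra_simps simp flip: power_add)
      also have "K * \<rho> ^ 4 / real (m + 1) * (H m * \<rho> ^ m + \<dots>)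
          \<le> K * \<rho> ^ 4 / real (m + 1) * (h + g * X)"
      proof (intro mult_left_mono add_mono h)
        have "(\<Sum>i\<le>m. (c i * \<rho> ^ i) * x (m - i)) \<le> (\<Sum>i\<le>m. (c i * \<rho> ^ i) * X)"
          using c0 \<rho>(1) n by (intro sum_mono mult_left_mono less.IH) auto
        also have "\<dots> \<le> g * X" unfolding sum_distrib_right[symmetric] by (intro mult_right_mono g X0)
        finally show "(\<Sum>i\<le>m. (c i * \<rho> ^ i) * x (m - i)) \<le> g * X" .
      qed (use K \<rho>(1) in auto)
      also have "\<dots> = K * \<rho> ^ 4 * h / real (m + 1) + K * \<rho> ^ 4 * g / real (m + 1) * X"
        by (simp add: algebra_simps add_divide_distrib)
      also have "K * \<rho> ^ 4 * h / real (m + 1) \<le> K * \<rho> ^ 4 * h / 1"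
        using Kh by (intro divide_left_mono) auto
      also have "K * \<rho> ^ 4 * g / real (m + 1) * X \<le> 1 / 2 * X"
        using M m by (intro mult_right_mono X0) (simp add: field_simps)
      also have "K * \<rho> ^ 4 * h / 1 + 1 / 2 * X \<le> X"
        unfolding X_def using S0 by (simp add: field_simps)
      finally show ?thesis by simp
    qed
  qed
  obtain N :: nat where N: "X \<le> real N" using real_arch_simple by blast
  have "norm (W n * \<rho> ^ n) \<le> real (n + 1)" if "n \<ge> N" for n
    using bd[of n] x0[of n] N that unfolding x_def by simp
  then show "\<exists>M. \<forall>m\<ge>M. norm (W m * \<rho> ^ m) \<le> real (m + 1)" by blast
qed

text \<open>\<open>T\<close> is the degreewise solution operator. The first four parts vanish
  because a multiple of \<open>Pt t\<close> starts in degree 4.\<close>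

function goursat_rec :: "(nat \<Rightarrow> complex poly \<Rightarrow> complex poly) \<Rightarrow> (nat \<Rightarrow> complex poly)
    \<Rightarrow> (nat \<Rightarrow> complex poly) \<Rightarrow> nat \<Rightarrow> complex poly" where
  "goursat_rec T c h n = (if n < 4 then 0
     else T (n - 4) (h (n - 4) - (\<Sum>i\<le>n - 4. c i * goursat_rec T c h (n - 4 - i))))"
  by auto
termination by (relation "Wellfounded.measure (\<lambda>(T, c, h, n). n)") auto

declare goursat_rec.simps [simp del]

lemma goursat_rec_less: "n < 4 \<Longrightarrow> goursat_rec T c h n = 0"
  by (simp add: goursat_rec.simps)

lemma goursat_rec_add_4: "goursat_rec T c h (m + 4) = T m (h m - cauchy_prod c (goursat_rec T c h) m)"
  by (subst goursat_rec.simps) (simp add: cauchy_prod_def)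

section \<open>The Goursat problem\<close>

lemma half_le_sin:
  fixes y :: real
  assumes "0 \<le> y" "y \<le> pi / 2"
  shows "y / 2 \<le> sin y"
proof -
  define u where "u = y / 2"
  have u: "0 \<le> u" "u \<le> pi" "y = 2 * u" using assms by (auto simp: u_def)
  \<comment> \<open>The derivative of \<open>sin x - x * cos x\<close> is \<open>x * sin x\<close>,
    which is nonnegative on this range.\<close>
  have "(\<lambda>x. sin x - x * cos x) 0 \<le> (\<lambda>x. sin x - x * cos x) u"
  proof (rule DERIV_nonneg_imp_nondecreasing[OF u(1)])
    fix x assume "0 \<le> x" "x \<le> u"
    then show "\<exists>y. ((\<lambda>x. sin x - x * cos x) has_real_derivative y) (at x) \<and> 0 \<le> y"
      using u by (intro exI[of _ "x * sin x"] conjI)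
        (auto intro!: derivative_eq_intros mult_nonneg_nonneg sin_ge_zero)
  qed
  then have *: "u * cos u \<le> sin u" by simp
  have "0 \<le> cos y" using assms by (intro cos_ge_zero) auto
  \<comment> \<open>From \<open>cos y = 2 * (cos u)\<^sup>2 - 1 \<ge> 0\<close>. With
    \<open>u * cos u \<le> sin u\<close>, the double angle formula for \<open>sin y\<close> then
    yields the factor \<open>1 / 2\<close>.\<close>
  then have c: "1 / 2 \<le> (cos u)\<^sup>2" by (simp add: u(3) cos_double_cos)
  have "0 \<le> cos u" using assms by (intro cos_ge_zero) (auto simp: u_def)
  have "y / 2 = 2 * u * (1 / 2)" by (simp add: u(3))
  also have "\<dots> \<le> 2 * u * (cos u)\<^sup>2" using u c by (intro mult_left_mono) auto
  also have "\<dots> = 2 * (u * cos u) * cos u" by (simp add: power2_eq_square)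
  also have "\<dots> \<le> 2 * sin u * cos u" using * \<open>0 \<le> cos u\<close> by (intro mult_right_mono) auto
  also have "\<dots> = sin y" by (simp add: u(3) sin_double)
  finally show ?thesis .
qed

lemma half_abs_le_abs_sin:
  fixes y :: real
  assumes "\<bar>y\<bar> \<le> pi / 2"
  shows "\<bar>y\<bar> / 2 \<le> \<bar>sin y\<bar>"
  using half_le_sin[of "\<bar>y\<bar>"] assms by (auto simp: abs_if split: if_splits)

text \<open>With \<open>x\<close> the difference of \<open>n * \<beta>\<close> and a nearest
  integer, the divisor has modulus \<open>2 * \<bar>sin (pi * x)\<bar>\<close>, which is at least
  \<open>\<bar>x\<bar>\<close>, and the condition with denominator \<open>n\<close> gives
  \<open>\<bar>x\<bar> \<ge> C / n\<close>. So \<open>C\<close> itself serves as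
  \<open>\<delta>\<close>.\<close>

lemma small_divisors_of_diophantine:
  assumes "C > 0"
    and "\<forall>n m :: int. m \<noteq> 0 \<longrightarrow> \<bar>\<beta> - real_of_int n / real_of_int m\<bar> \<ge> C / (real_of_int m)\<^sup>2"
  shows "small_divisors (exp (2 * of_real pi * \<i> * of_real \<beta>)) C"
proof
  show "norm (exp (2 * of_real pi * \<i> * of_real \<beta>)) = 1" by simp
  show "C > 0" by fact
  fix n :: nat assume n: "n > 0"
  define k where "k = round (real n * \<beta>)"
  define x where "x = real n * \<beta> - of_int k"
  have x: "\<bar>x\<bar> \<le> 1 / 2" unfolding x_def k_def using of_int_round_abs_le[of "real n * \<beta>"] by linarith
  have "C / (real n)\<^sup>2 \<le> \<bar>\<beta> - real_of_int k / real n\<bar>"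
    using assms(2)[rule_format, of "int n" k] n by simp
  then have "C / (real n)\<^sup>2 * real n \<le> \<bar>\<beta> - real_of_int k / real n\<bar> * real n"
    by (intro mult_right_mono) auto
  also have "\<dots> = \<bar>x\<bar>"
  proof -
    have "x = (\<beta> - real_of_int k / real n) * real n" using n by (simp add: x_def field_simps)
    then show ?thesis by (simp add: abs_mult)
  qed
  finally have Cx: "C / real n \<le> \<bar>x\<bar>" using n by (simp add: power2_eq_square)
  have "exp (2 * of_real pi * \<i> * of_real \<beta>) ^ n = exp (of_nat n * (2 * of_real pi * \<i> * of_real \<beta>))"
    by (simp add: exp_of_nat_mult)
  also have "of_nat n * (2 * of_real pi * \<i> * of_real \<beta>) = \<i> * of_real (2 * pi * x) + of_int k * (2 * of_real pi * \<i>)"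
    by (simp add: x_def algebra_simps)
  also have "exp \<dots> = exp (\<i> * of_real (2 * pi * x))"
  proof -
    have "exp (of_int k * (2 * of_real pi * \<i>)) = 1"
      unfolding exp_eq_1 by (auto intro: exI[of _ k])
    then show ?thesis by (simp add: exp_add)
  qed
  finally have "norm (exp (2 * of_real pi * \<i> * of_real \<beta>) ^ n - 1) = 2 * \<bar>sin (pi * x)\<bar>"
    using dist_exp_i_1[of "2 * pi * x"] by simp
  moreover have "\<bar>pi * x\<bar> / 2 \<le> \<bar>sin (pi * x)\<bar>"
    using x by (intro half_abs_le_abs_sin) (simp add: abs_mult)
  moreover have "\<bar>x\<bar> \<le> \<bar>pi * x\<bar>" using pi_ge_two by (simp add: abs_mult mult_le_cancel_right1)
  ultimately show "C / real n \<le> norm (exp (2 * of_real pi * \<i> * of_real \<beta>) ^ n - 1)"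
    using Cx by linarith
qed

section \<open>The problem for coefficient sequences\<close>

definition single :: "nat \<Rightarrow> complex poly \<Rightarrow> nat \<Rightarrow> complex poly" where
  "single k p m = (if m = k then p else 0)"

lemma cauchy_prod_single: "cauchy_prod (single k p) q m = (if m < k then 0 else p * q (m - k))"
  by (simp add: cauchy_prod_def single_def if_distribR if_distrib cong: if_cong)

lemma expands_single:
  assumes "degree p \<le> k" "\<And>z. f z = hpoly k p (to_complex z)"
  shows "expands R f (single k p)"
  unfolding expands_def conv_coeffs_def summable_below_def
proof (intro conjI allI impI ballI)
  show "degree (single k p m) \<le> m" for m using assms(1) by (simp add: single_def)
  show "summable (\<lambda>m. pnorm (single k p m) * \<rho> ^ m)" for \<rho>
    by (rule summable_finite[of "{k}"]) (auto simp: single_def)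
  fix z
  have "hser (single k p) (to_complex z) = (\<Sum>m\<in>{k}. hpoly m (single k p m) (to_complex z))"
    unfolding hser_def by (intro suminf_finite) (auto simp: single_def)
  then show "f z = hser (single k p) (to_complex z)" by (simp add: assms(2) single_def)
qed

context small_divisors
begin

text \<open>In the variable \<open>z / cnj z\<close> each of the four linear factors of
  \<open>Pt t\<close> is a constant times one monic linear factor of \<open>Q\<close>;
  \<open>k\<close> is the product of the constants.\<close>

lemma expands_Pt:
  assumes t: "t > 0" and \<omega>: "\<omega> = (of_real t + \<i>) / (of_real t - \<i>)"
  obtains k where "k \<noteq> 0" "\<And>R. expands R (Pt t) (single 4 (smult k Q))"
proof -
  define u v where "u = of_real t + \<i>" and "v = of_real t - \<i>"
  have uv: "u \<noteq> 0" "v \<noteq> 0" using t by (auto simp: u_def v_def complex_eq_iff)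
  have T: "of_real t \<noteq> (0 :: complex)" using t by simp
  define L1 L2 where "L1 = Xp - smult (of_real t) Yp" and "L2 = Xp - smult (1 / of_real t) Yp"
  have X: "Xp = smult (1 / 2) [:1, 1:]" and Y: "Yp = smult (- \<i> / 2) [:-1, 1:]"
    by (simp_all add: Xp_def Yp_def)
  have L1: "L1 = smult (\<i> * v / 2) [:- \<omega>, 1:]"
  proof -
    have "\<i> * v / 2 * \<omega> = \<i> * u / 2" using uv by (simp add: \<omega> flip: u_def v_def)
    then show ?thesis by (simp add: L1_def Xp_def Yp_def u_def v_def field_simps)
  qed
  have L2: "L2 = smult (u / (2 * of_real t)) [:1 / \<omega>, 1:]"
  proof -
    have "u / (2 * of_real t) * (1 / \<omega>) = v / (2 * of_real t)" using uv by (simp add: \<omega> flip: u_def v_def)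
    then show ?thesis using T by (simp add: L2_def Xp_def Yp_def u_def v_def field_simps)
  qed
  define k where "k = (1 / 2) * (- \<i> / 2) * (\<i> * v / 2) * (u / (2 * of_real t))"
  have k: "k \<noteq> 0" using uv T by (simp add: k_def)
  have kQ: "smult k Q = Xp * (Yp * (L1 * L2))"
    unfolding X Y L1 L2 Q_def k_def
    by (simp only: mult_smult_left mult_smult_right smult_smult mult_ac)
  have d: "degree L1 \<le> 1" "degree L2 \<le> 1" by (simp_all add: L1 L2)
  then have d2: "degree (L1 * L2) \<le> 2" using degree_mult_le[of L1 L2] by linarith
  then have d3: "degree (Yp * (L1 * L2)) \<le> 3" using degree_mult_le[of Yp "L1 * L2"] degree_Yp by linarith
  then have d4: "degree (smult k Q) \<le> 4"
    unfolding kQ using degree_mult_le[of Xp "Yp * (L1 * L2)"] degree_Xp by linarith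
  have "Pt t p = hpoly 4 (smult k Q) (to_complex p)" for p
  proof -
    obtain x y where p: "p = (x, y)" by (cases p)
    note h1 = hpoly_1_Xp[of x y] hpoly_1_Yp[of x y]
    have l: "hpoly 1 L1 (to_complex p) = of_real (x - t * y)" "hpoly 1 L2 (to_complex p) = of_real (x - y / t)"
      unfolding L1_def L2_def hpoly_diff hpoly_smult p h1 by simp_all
    \<comment> \<open>The degree is written as a nested sum so that \<open>hpoly_mult\<close> splits
      off one linear factor at a time.\<close>
    have "hpoly (1 + (1 + (1 + 1))) (smult k Q) (to_complex p) = of_real x * (of_real y * (of_real (x - t * y) * of_real (x - y / t)))"
      unfolding kQ using d d2 d3 degree_Xp degree_Yp
      by (subst hpoly_mult, simp, simp)+ (simp only: l[unfolded p] p h1)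
    moreover have "1 + (1 + (1 + 1)) = (4 :: nat)" by simp
    ultimately show ?thesis by (simp only: Pt_def p prod.case of_real_mult mult.assoc)
  qed
  then have "expands R (Pt t) (single 4 (smult k Q))" for R by (rule expands_single[OF d4])
  with k show thesis using that by blast
qed

lemma coeff_solution_exists:
  assumes c: "conv_coeffs R c" and h: "conv_coeffs R h" and k: "k \<noteq> 0"
  obtains w q where "conv_coeffs R w" "conv_coeffs R q" "w = cauchy_prod (single 4 (smult k Q)) q"
    "\<And>m. bilap w m + cauchy_prod c w m = h m"
proof -
  define K where "K = 3 + 16 * K\<^sub>0"
  have "\<exists>T. \<forall>m h. degree h \<le> m \<longrightarrow> degree (T m h) \<le> m + 4 \<and> bilap_hom m (T m h) = h \<and> Q dvd T m h
      \<and> pnorm (T m h) \<le> K / real (m + 1) * pnorm h"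
    unfolding K_def by (intro choice allI) (metis bilap_hom_solve)
  then obtain T where T: "\<And>m h. degree h \<le> m \<Longrightarrow> degree (T m h) \<le> m + 4"
    "\<And>m h. degree h \<le> m \<Longrightarrow> bilap_hom m (T m h) = h" "\<And>m h. degree h \<le> m \<Longrightarrow> Q dvd T m h"
    "\<And>m h. degree h \<le> m \<Longrightarrow> pnorm (T m h) \<le> K / real (m + 1) * pnorm h"
    by metis
  define w where "w = goursat_rec T c h"
  have w0: "w n = 0" if "n < 4" for n using that by (simp add: w_def goursat_rec_less)
  have w4: "w (m + 4) = T m (h m - cauchy_prod c w m)" for m by (simp add: w_def goursat_rec_add_4)
  have dw: "degree (w n) \<le> n" for n
  proof (induction n rule: less_induct)
    case (less n)
    show ?case
    proof (cases "n < 4")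
      case False
      then obtain m where n: "n = m + 4" by (metis add.commute le_Suc_ex not_less)
      have "degree (cauchy_prod c w m) \<le> m"
        unfolding cauchy_prod_def
      proof (intro degree_sum_le)
        fix i assume "i \<in> {..m}"
        then have i: "i \<le> m" "m - i < n" using n by auto
        show "degree (c i * w (m - i)) \<le> m"
          using degree_mult_le[of "c i" "w (m - i)"] conv_coeffs_degree[OF c, of i] less.IH[OF i(2)] i(1)
          by linarith
      qed simp
      then show ?thesis unfolding n w4
        by (intro T degree_diff_le conv_coeffs_degree[OF h])
    qed (simp add: w0)
  qed
  have dg: "degree (h m - cauchy_prod c w m) \<le> m" for m
    by (intro degree_diff_le conv_coeffs_degree[OF h] degree_cauchy_prod conv_coeffs_degree[OF c] dw)
  have eq: "bilap w m + cauchy_prod c w m = h m" for m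
    by (simp add: bilap_eq_bilap_hom w4 T(2)[OF dg])
  have "summable_below R (\<lambda>n. pnorm (w n))"
  proof (rule summable_below_recursion[where H = "\<lambda>m. pnorm (h m)" and c = "\<lambda>m. pnorm (c m)" and K = K])
    show K0: "0 \<le> K" using K\<^sub>0_pos by (simp add: K_def)
    show "pnorm (w (m + 4)) \<le> K / real (m + 1) * (pnorm (h m) + (\<Sum>i\<le>m. pnorm (c i) * pnorm (w (m - i))))" for m
    proof -
      have "pnorm (w (m + 4)) \<le> K / real (m + 1) * pnorm (h m - cauchy_prod c w m)"
        unfolding w4 by (rule T(4)[OF dg])
      also have "pnorm (h m - cauchy_prod c w m) \<le> pnorm (h m) + (\<Sum>i\<le>m. pnorm (c i) * pnorm (w (m - i)))"
        using pnorm_diff[of "h m" "cauchy_prod c w m"] pnorm_cauchy_prod[of c w m] by linarith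
      finally show ?thesis using K0 by (simp add: mult_left_mono divide_right_mono)
    qed
  qed (auto intro: conv_coeffs_summable_below c h)
  then have cw: "conv_coeffs R w" using dw by (simp add: conv_coeffs_def)
  \<comment> \<open>The division is exact, since every \<open>w (m + 4)\<close> is a value of
    \<open>T\<close> and hence divisible by \<open>Q\<close>.\<close>
  define q where "q m = w (m + 4) div smult k Q" for m
  have "smult k Q dvd w (m + 4)" for m
    unfolding w4 using T(3)[OF dg] k by (simp add: smult_dvd_iff)
  then have wq: "w (m + 4) = smult k Q * q m" for m
    unfolding q_def by (simp only: dvd_mult_div_cancel)
  have Q0: "Q \<noteq> 0" by (simp add: Q_def)
  have dQ: "degree Q = 4" by (simp add: Q_def degree_mult_eq \<omega>_nz del: mult_pCons_left mult_pCons_right)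
  have dq: "degree (q m) \<le> m" for m
  proof (cases "q m = 0")
    case False
    then have "degree (w (m + 4)) = 4 + degree (q m)"
      unfolding wq using Q0 k dQ by (simp add: degree_mult_eq)
    then show ?thesis using dw[of "m + 4"] by simp
  qed simp
  \<comment> \<open>Dividing by \<open>Q\<close> costs the fourth power of the degree, which the
    weights absorb at every radius below \<open>R\<close>.\<close>
  have "summable_below R (\<lambda>m. 256 / norm k * (real (m + 1) ^ 4 * pnorm (w (m + 4))))"
    by (intro summable_below_cmult summable_below_weight summable_below_shift conv_coeffs_summable_below[OF cw])
  then have "summable_below R (\<lambda>m. pnorm (q m))"
  proof (rule summable_below_mono)
    fix m
    have "pnorm (w (m + 4)) = norm k * pnorm (Q * q m)" by (simp add: wq)
    then show "pnorm (q m) \<le> 256 / norm k * (real (m + 1) ^ 4 * pnorm (w (m + 4)))"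
      using pnorm_le_Q_mult[OF dq, of m] k by simp
  qed simp
  then have cq: "conv_coeffs R q" using dq by (simp add: conv_coeffs_def)
  have "w = cauchy_prod (single 4 (smult k Q)) q"
  proof
    fix n
    show "w n = cauchy_prod (single 4 (smult k Q)) q n"
      using w0[of n] wq[of "n - 4"] by (cases "n < 4") (simp_all add: cauchy_prod_single)
  qed
  then show thesis using that cw cq eq by blast
qed

text \<open>Induction on the degree: once the lower parts vanish the product with \<open>c\<close>
  drops out, and a form with vanishing bilaplacian that is divisible by \<open>Q\<close> is
  0.\<close>

lemma coeff_solution_unique:
  assumes d: "\<And>m. degree (w m) \<le> m" and eq: "\<And>m. bilap w m + cauchy_prod c w m = 0"
    and wq: "w = cauchy_prod (single 4 (smult k Q)) q"
  shows "w n = 0"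
proof (induction n rule: less_induct)
  case (less n)
  show ?case
  proof (cases "n < 4")
    case True
    then show ?thesis by (subst wq) (simp add: cauchy_prod_single)
  next
    case False
    then obtain m where n: "n = m + 4" by (metis add.commute le_Suc_ex not_less)
    have "cauchy_prod c w m = 0" unfolding cauchy_prod_def using less.IH n by (intro sum.neutral) auto
    then have "bilap_hom m (w (m + 4)) = 0" using eq[of m] by (simp add: bilap_eq_bilap_hom)
    moreover have "Q dvd w (m + 4)"
      by (subst wq) (simp add: cauchy_prod_single dvd_smult)
    ultimately show ?thesis using bilap_hom_unique[OF d] n by blast
  qed
qed

end

section \<open>Existence and uniqueness on the full disc\<close>

theorem theorem6p1:
  fixes t \<beta> C :: real and R :: ereal and c :: "real \<times> real \<Rightarrow> complex"
  assumes "t > 0"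
    and "0 < \<beta>" "\<beta> < 1"
    and "(complex_of_real t + \<i>) / (complex_of_real t - \<i>) = exp (2 * of_real pi * \<i> * of_real \<beta>)"
    and "C > 0"
    and "\<forall>n m :: int. m \<noteq> 0 \<longrightarrow> \<bar>\<beta> - real_of_int n / real_of_int m\<bar> \<ge> C / (real_of_int m)\<^sup>2"
    and "0 < R"
    and "c \<in> A_alg R"
  shows "\<exists>r. 0 < r \<and> r \<le> R \<and>
    (\<forall>f\<in>A_alg R. \<forall>g\<in>A_alg R.
       (\<exists>u. goursat_sol t r c f g u) \<and>
       (\<forall>u v. goursat_sol t r c f g u \<longrightarrow> goursat_sol t r c f g v \<longrightarrow> (\<forall>p\<in>disc r. u p = v p)))"
proof (intro exI[of _ R] conjI ballI allI impI)
  interpret small_divisors "exp (2 * of_real pi * \<i> * of_real \<beta>)" C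
    by (rule small_divisors_of_diophantine[OF assms(5,6)])
  obtain k where k: "k \<noteq> 0" and Pt: "expands R (Pt t) (single 4 (smult k Q))"
    using expands_Pt[OF assms(1) assms(4)[symmetric]] by blast
  obtain ca where ca: "expands R c ca" using A_alg_imp_expands[OF assms(8)] .
  show "0 < R" by fact
  show "R \<le> R" by simp
  fix f g assume "f \<in> A_alg R" "g \<in> A_alg R"
  then obtain fa ga where fa: "expands R f fa" and ga: "expands R g ga" by (metis A_alg_imp_expands)
  show "\<exists>u. goursat_sol t R c f g u"
  proof -
    \<comment> \<open>Right-hand side of the problem for \<open>v = u - g\<close>, which must be a
      multiple of \<open>Pt t\<close>.\<close>
    define h where "h p = f p - (laplacian (laplacian g) p + c p * g p)" for p
    obtain ha where ha: "expands R h ha"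
      unfolding h_def[abs_def] using expands_diff[OF fa expands_add[OF expands_bilaplacian[OF ga] expands_mult[OF ca ga]]] by blast
    obtain w q where w: "conv_coeffs R w" and q: "conv_coeffs R q"
      and wq: "w = cauchy_prod (single 4 (smult k Q)) q" and eq: "\<And>m. bilap w m + cauchy_prod ca w m = ha m"
      using coeff_solution_exists[OF expands_coeffs[OF ca] expands_coeffs[OF ha] k] by blast
    define v where "v p = hser w (to_complex p)" for p
    have v: "expands R v w" unfolding v_def[abs_def] by (rule expands_hser[OF w])
    define u where "u p = hser (\<lambda>m. ga m + w m) (to_complex p)" for p
    have u: "expands R u (\<lambda>m. ga m + w m)"
      unfolding u_def[abs_def] by (intro expands_hser conv_coeffs_add w expands_coeffs[OF ga])
    have ug: "u p = g p + v p" if "p \<in> disc R" for p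
      using expands_eq[OF u that] expands_eq[OF expands_add[OF ga v] that] by simp
    have "laplacian (laplacian u) p + c p * u p = f p" if p: "p \<in> disc R" for p
    proof -
      have "bilap (\<lambda>m. ga m + w m) = (\<lambda>m. bilap ga m + bilap w m)"
        by (simp add: fun_eq_iff bilap_eq_bilap_hom bilap_hom_add)
      then have "laplacian (laplacian u) p = laplacian (laplacian g) p + laplacian (laplacian v) p"
        using expands_eq[OF expands_bilaplacian[OF u] p]
          expands_eq[OF expands_add[OF expands_bilaplacian[OF ga] expands_bilaplacian[OF v]] p] by simp
      moreover have "laplacian (laplacian v) p + c p * v p = h p"
        using expands_eq[OF expands_add[OF expands_bilaplacian[OF v] expands_mult[OF ca v]] p] expands_eq[OF ha p]
        by (simp add: eq)
      ultimately show ?thesis using ug[OF p] by (simp add: h_def algebra_simps)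
    qed
    moreover have "u p - g p = Pt t p * hser q (to_complex p)" if p: "p \<in> disc R" for p
      using expands_eq[OF expands_mult[OF Pt expands_hser[OF q]] p] ug[OF p] by (simp add: v_def wq)
    ultimately have "goursat_sol t R c f g u"
      unfolding goursat_sol_def
      by (intro conjI ballI bexI[of _ "\<lambda>p. hser q (to_complex p)"])
        (auto intro: expands_imp_A_alg[OF u assms(7)] expands_imp_A_alg[OF expands_hser[OF q] assms(7)])
    then show ?thesis by blast
  qed
  fix u v p assume u: "goursat_sol t R c f g u" and v: "goursat_sol t R c f g v" and p: "p \<in> disc R"
  from u v obtain q1 q2 where q: "q1 \<in> A_alg R" "q2 \<in> A_alg R"
    "\<And>p. p \<in> disc R \<Longrightarrow> u p - g p = Pt t p * q1 p" "\<And>p. p \<in> disc R \<Longrightarrow> v p - g p = Pt t p * q2 p"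
    unfolding goursat_sol_def by blast
  from u v obtain ua va where ua: "expands R u ua" and va: "expands R v va"
    unfolding goursat_sol_def by (meson A_alg_imp_expands)
  from q obtain qa qb where qa: "expands R q1 qa" and qb: "expands R q2 qb" by (meson A_alg_imp_expands)
  \<comment> \<open>The difference of two solutions solves the problem with zero right-hand side and
    is \<open>Pt t\<close> times \<open>q1 - q2\<close>.\<close>
  define w where "w m = ua m - va m" for m
  have uv: "expands R (\<lambda>p. u p - v p) w" unfolding w_def[abs_def] by (rule expands_diff[OF ua va])
  have "w m = 0" for m
  proof (rule coeff_solution_unique)
    show "degree (w m) \<le> m" for m by (rule conv_coeffs_degree[OF expands_coeffs[OF uv]])
    \<comment> \<open>Uniqueness of expansions turns divisibility of functions into an identity
      between coefficients.\<close>
    show "w = cauchy_prod (single 4 (smult k Q)) (\<lambda>m. qa m - qb m)"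
    proof
      fix m show "w m = cauchy_prod (single 4 (smult k Q)) (\<lambda>m. qa m - qb m) m"
      proof (rule expands_unique[OF uv expands_mult[OF Pt expands_diff[OF qa qb]] assms(7)])
        fix p assume "p \<in> disc R"
        then show "u p - v p = Pt t p * (q1 p - q2 p)"
          using q(3,4)[of p] by (simp add: algebra_simps)
      qed
    qed
    fix m
    note Lu = expands_add[OF expands_bilaplacian[OF ua] expands_mult[OF ca ua]]
      and Lv = expands_add[OF expands_bilaplacian[OF va] expands_mult[OF ca va]]
    have "bilap ua m + cauchy_prod ca ua m = bilap va m + cauchy_prod ca va m"
      by (rule expands_unique[OF Lu Lv assms(7)]) (use u v in \<open>simp add: goursat_sol_def\<close>)
    moreover have "bilap w m = bilap ua m - bilap va m"
      by (simp add: bilap_eq_bilap_hom w_def bilap_hom_diff)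
    moreover have "cauchy_prod ca w m = cauchy_prod ca ua m - cauchy_prod ca va m"
      by (simp add: cauchy_prod_def w_def algebra_simps sum_subtractf)
    moreover have "a - b + (c - d) = a + c - (b + d)" for a b c d :: "complex poly" by simp
    ultimately show "bilap w m + cauchy_prod ca w m = 0" by (simp only: right_minus_eq)
  qed
  then have "w = (\<lambda>m. 0)" by (simp add: fun_eq_iff)
  then show "u p = v p" using expands_eq[OF uv p] by (simp add: hser_def)
qed

end
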